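(* Let $(\mathbf{X},\mathbf{T})$ be a nonautonomous dynamical system, let $K\subset X_0$ be non-empty and compact, and let $\mathbf{f}\in\mathbf{C}(\mathbf{X},\mathbb{R})$ be equicontinuous with $\|\mathbf{f}\|<+\infty$. If $P^{\mathrm{P}}(\mathbf{T},\mathbf{f},K)>\|\mathbf{f}\|$, then $$P^{\mathrm{P}}(\mathbf{T},\mathbf{f},K)=\sup\{\overline{P}_{\mu}(\mathbf{T},\mathbf{f}):\mu\in M(X_0),\ \mu(K)=1\}.$$
   Context: A nonautonomous dynamical system (NDS) $(\mathbf{X},\mathbf{T})$ consists of a sequence $\mathbf{X}=\{X_k\}_{k=0}^\infty$ of compact metric spaces $(X_k,d_k)$ and a sequence $\mathbf{T}=\{T_k\}_{k=0}^\infty$ of continuous maps $T_k:X_k\to X_{k+1}$. Put $\mathbf{T}^0=\mathrm{id}_{X_0}$ and $\mathbf{T}^j=T_{j-1}\circ\cdots\circ T_0:X_0\to X_j$. For $n\ge1$ and $x,y\in X_0$ let $d_n^{\mathbf{T}}(x,y)=\max_{0\le j\le n-1}d_j(\mathbf{T}^jx,\mathbf{T}^jy)$, and for $\varepsilon>0$ let $B_n^{\mathbf{T}}(x,\varepsilon)=\{y\in X_0:d_n^{\mathbf{T}}(x,y)<\varepsilon\}$ and $\overline{B}_n^{\mathbf{T}}(x,\varepsilon)=\{y\in X_0:d_n^{\mathbf{T}}(x,y)\le\varepsilon\}$ (open and closed Bowen balls). $M(X_0)$ is the set of Borel probability measures on $X_0$. $\mathbf{C}(\mathbf{X},\mathbb{R})=\prod_{k\ge0}C(X_k,\mathbb{R})$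 is the set of sequences $\mathbf{f}=\{f_k\}_{k=0}^\infty$ of continuous functions $f_k:X_k\to\mathbb{R}$; $\|\mathbf{f}\|=\sup_{k\ge0}\max_{x\in X_k}|f_k(x)|$. $\mathbf{f}$ is equicontinuous if for every $\varepsilon>0$ there is $\delta>0$ such that for all $k\ge0$ and all $x',x''\in X_k$ with $d_k(x',x'')<\delta$ one has $|f_k(x')-f_k(x'')|<\varepsilon$. Put $S_n^{\mathbf{T}}\mathbf{f}=\sum_{j=0}^{n-1}f_j\circ\mathbf{T}^j$. Measure-theoretic upper local pressure: $\overline{P}_\mu(\mathbf{T},\mathbf{f},x)=\lim_{\varepsilon\to0}\limsup_{n\to\infty}\frac{-\log\mu(B_n^{\mathbf{T}}(x,\varepsilon))+S_n^{\mathbf{T}}\mathbf{f}(x)}{n}$, with $\log0=-\infty$ (the inner quantity is non-increasing in $\varepsilon$). Measure-theoretic upper pressure: $\overline{P}_\mu(\mathbf{T},\mathbf{f})=\int_{X_0}\overline{P}_\mu(\mathbf{T},\mathbf{f},x)\,d\mu(x)$. Packing pressure: for $Z\subset X_0$, an $(N,\varepsilon)$-packing of $Z$ is a family of pairwise disjoint closed Bowen balls $\{\overline{B}_{n_i}^{\mathbf{T}}(x_i,\varepsilon)\}_i$ with $x_i\in Z$ and integers $n_i\ge N$. For $s\in\mathbb{R}$, $N>0$, $\varepsilon>0$ let $\mathscr{P}_{N,\varepsilon}^{s}(\mathbf{T},\mathbf{f},Z)=\sup\sum_i\exp(-n_is+S_{n_i}^{\mathbf{T}}\mathbf{f}(x_i))$,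 the supremum over all countable (finite or infinite) $(N,\varepsilon)$-packings of $Z$; $\mathscr{P}_{\infty,\varepsilon}^{s}(\mathbf{T},\mathbf{f},Z)=\lim_{N\to\infty}\mathscr{P}_{N,\varepsilon}^{s}(\mathbf{T},\mathbf{f},Z)$; $\mathscr{P}_{\varepsilon}^{s}(\mathbf{T},\mathbf{f},Z)=\inf\{\sum_{i=1}^\infty\mathscr{P}_{\infty,\varepsilon}^{s}(\mathbf{T},\mathbf{f},Z_i):\bigcup_{i=1}^\infty Z_i\supseteq Z\}$; $P^{\mathrm{P}}(\mathbf{T},\mathbf{f},Z,\varepsilon)=\inf\{s:\mathscr{P}_{\varepsilon}^{s}(\mathbf{T},\mathbf{f},Z)=0\}=\sup\{s:\mathscr{P}_{\varepsilon}^{s}(\mathbf{T},\mathbf{f},Z)=+\infty\}$. Then $P^{\mathrm{P}}(\mathbf{T},\mathbf{f},Z)=\lim_{\varepsilon\to0}P^{\mathrm{P}}(\mathbf{T},\mathbf{f},Z,\varepsilon)$ (monotone limit). *)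

theory Defs
  imports "HOL-Probability.Probability"
begin

(* The spaces X_k are arbitrary metrics (of type 'a metric) with carriers inside one common
   element type; the carriers are unrelated and may differ, as may the metrics.  Functions on X_k
   are HOL functions on 'a of which only the values on mspace (X k) matter. *)

definition nds :: "(nat \<Rightarrow> 'a metric) \<Rightarrow> (nat \<Rightarrow> 'a \<Rightarrow> 'a) \<Rightarrow> bool" where
  "nds X T \<longleftrightarrow>
     (\<forall>k. compact_space (mtopology_of (X k))) \<and>
     (\<forall>k. continuous_map (mtopology_of (X k)) (mtopology_of (X (Suc k))) (T k))"

primrec iter :: "(nat \<Rightarrow> 'a \<Rightarrow> 'a) \<Rightarrow> nat \<Rightarrow> 'a \<Rightarrow> 'a" where
  "iter T 0 = id"
| "iter T (Suc j) = T j \<circ> iter T j"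

(* Meaningful for n \<ge> 1 only. *)
definition bowen_dist ::
    "(nat \<Rightarrow> 'a metric) \<Rightarrow> (nat \<Rightarrow> 'a \<Rightarrow> 'a) \<Rightarrow> nat \<Rightarrow> 'a \<Rightarrow> 'a \<Rightarrow> real" where
  "bowen_dist X T n x y = Max ((\<lambda>j. mdist (X j) (iter T j x) (iter T j y)) ` {..<n})"

definition bowen_ball ::
    "(nat \<Rightarrow> 'a metric) \<Rightarrow> (nat \<Rightarrow> 'a \<Rightarrow> 'a) \<Rightarrow> nat \<Rightarrow> 'a \<Rightarrow> real \<Rightarrow> 'a set" where
  "bowen_ball X T n x \<epsilon> = {y \<in> mspace (X 0). bowen_dist X T n x y < \<epsilon>}"

definition bowen_cball ::
    "(nat \<Rightarrow> 'a metric) \<Rightarrow> (nat \<Rightarrow> 'a \<Rightarrow> 'a) \<Rightarrow> nat \<Rightarrow> 'a \<Rightarrow> real \<Rightarrow> 'a set" where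
  "bowen_cball X T n x \<epsilon> = {y \<in> mspace (X 0). bowen_dist X T n x y \<le> \<epsilon>}"

definition continuous_seq :: "(nat \<Rightarrow> 'a metric) \<Rightarrow> (nat \<Rightarrow> 'a \<Rightarrow> real) \<Rightarrow> bool" where
  "continuous_seq X f \<longleftrightarrow> (\<forall>k. continuous_map (mtopology_of (X k)) euclideanreal (f k))"

definition equicontinuous_seq :: "(nat \<Rightarrow> 'a metric) \<Rightarrow> (nat \<Rightarrow> 'a \<Rightarrow> real) \<Rightarrow> bool" where
  "equicontinuous_seq X f \<longleftrightarrow>
     (\<forall>\<epsilon>>0. \<exists>\<delta>>0. \<forall>k. \<forall>x\<in>mspace (X k). \<forall>y\<in>mspace (X k).
        mdist (X k) x y < \<delta> \<longrightarrow> \<bar>f k x - f k y\<bar> < \<epsilon>)"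

definition seq_norm :: "(nat \<Rightarrow> 'a metric) \<Rightarrow> (nat \<Rightarrow> 'a \<Rightarrow> real) \<Rightarrow> ereal" where
  "seq_norm X f = (SUP k. SUP x\<in>mspace (X k). ereal \<bar>f k x\<bar>)"

definition birkhoff_sum ::
    "(nat \<Rightarrow> 'a \<Rightarrow> 'a) \<Rightarrow> (nat \<Rightarrow> 'a \<Rightarrow> real) \<Rightarrow> nat \<Rightarrow> 'a \<Rightarrow> real" where
  "birkhoff_sum T f n x = (\<Sum>j<n. f j (iter T j x))"

definition borel_of :: "'a topology \<Rightarrow> 'a measure" where
  "borel_of U = sigma (topspace U) {A. openin U A}"

definition borel_probs :: "'a metric \<Rightarrow> 'a measure set" where
  "borel_probs m = {\<mu>. prob_space \<mu> \<and> sets \<mu> = sets (borel_of (mtopology_of m))}"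

definition log_ext :: "real \<Rightarrow> ereal" where
  "log_ext p = (if p = 0 then - \<infinity> else ereal (ln p))"

(* Here and in packing_pressure the argument of Lim is antitone in \<epsilon>, so that the limit exists;
   likewise for lim in packing_pre_inf, whose argument is antitone in N. *)
definition upper_local_pressure ::
    "(nat \<Rightarrow> 'a metric) \<Rightarrow> (nat \<Rightarrow> 'a \<Rightarrow> 'a) \<Rightarrow> (nat \<Rightarrow> 'a \<Rightarrow> real) \<Rightarrow> 'a measure \<Rightarrow> 'a \<Rightarrow> ereal" where
  "upper_local_pressure X T f \<mu> x =
     Lim (at_right 0) (\<lambda>\<epsilon>. limsup (\<lambda>n.
       (- log_ext (measure \<mu> (bowen_ball X T n x \<epsilon>)) + ereal (birkhoff_sum T f n x)) / ereal (real n)))"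

(* The Lebesgue integral of an extended-real function, as the integral of its positive part minus
   that of its negative part (e2ennreal sends negative values to 0).  For bounded f and a
   probability measure, upper_local_pressure is bounded below by minus the norm of f, so the
   undetermined form \<infinity> - \<infinity> does not arise. *)
definition ereal_integral :: "'a measure \<Rightarrow> ('a \<Rightarrow> ereal) \<Rightarrow> ereal" where
  "ereal_integral \<mu> g =
     enn2ereal (\<integral>\<^sup>+ x. e2ennreal (g x) \<partial>\<mu>) - enn2ereal (\<integral>\<^sup>+ x. e2ennreal (- g x) \<partial>\<mu>)"

definition upper_pressure ::
    "(nat \<Rightarrow> 'a metric) \<Rightarrow> (nat \<Rightarrow> 'a \<Rightarrow> 'a) \<Rightarrow> (nat \<Rightarrow> 'a \<Rightarrow> real) \<Rightarrow> 'a measure \<Rightarrow> ereal" where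
  "upper_pressure X T f \<mu> = ereal_integral \<mu> (upper_local_pressure X T f \<mu>)"

(* A countable family of closed Bowen balls is given by an index set I of naturals (finite or
   infinite) together with the orders n i and the centres x i. *)
definition packing ::
    "(nat \<Rightarrow> 'a metric) \<Rightarrow> (nat \<Rightarrow> 'a \<Rightarrow> 'a) \<Rightarrow> nat \<Rightarrow> real \<Rightarrow> 'a set \<Rightarrow>
     nat set \<Rightarrow> (nat \<Rightarrow> nat) \<Rightarrow> (nat \<Rightarrow> 'a) \<Rightarrow> bool" where
  "packing X T N \<epsilon> Z I n x \<longleftrightarrow>
     (\<forall>i\<in>I. x i \<in> Z \<and> N \<le> n i) \<and>
     disjoint_family_on (\<lambda>i. bowen_cball X T (n i) (x i) \<epsilon>) I"

definition packing_pre ::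
    "(nat \<Rightarrow> 'a metric) \<Rightarrow> (nat \<Rightarrow> 'a \<Rightarrow> 'a) \<Rightarrow> (nat \<Rightarrow> 'a \<Rightarrow> real) \<Rightarrow> real \<Rightarrow> nat \<Rightarrow> real \<Rightarrow>
     'a set \<Rightarrow> ennreal" where
  "packing_pre X T f s N \<epsilon> Z =
     (SUP (I, n, x) \<in> {(I, n, x). packing X T N \<epsilon> Z I n x}.
        \<Sum>\<^sub>\<infinity>i\<in>I. ennreal (exp (- real (n i) * s + birkhoff_sum T f (n i) (x i))))"

definition packing_pre_inf ::
    "(nat \<Rightarrow> 'a metric) \<Rightarrow> (nat \<Rightarrow> 'a \<Rightarrow> 'a) \<Rightarrow> (nat \<Rightarrow> 'a \<Rightarrow> real) \<Rightarrow> real \<Rightarrow> real \<Rightarrow>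
     'a set \<Rightarrow> ennreal" where
  "packing_pre_inf X T f s \<epsilon> Z = lim (\<lambda>N. packing_pre X T f s N \<epsilon> Z)"

definition packing_measure ::
    "(nat \<Rightarrow> 'a metric) \<Rightarrow> (nat \<Rightarrow> 'a \<Rightarrow> 'a) \<Rightarrow> (nat \<Rightarrow> 'a \<Rightarrow> real) \<Rightarrow> real \<Rightarrow> real \<Rightarrow>
     'a set \<Rightarrow> ennreal" where
  "packing_measure X T f s \<epsilon> Z =
     (INF C \<in> {C :: nat \<Rightarrow> 'a set. (\<forall>i. C i \<subseteq> mspace (X 0)) \<and> Z \<subseteq> (\<Union>i. C i)}.
        \<Sum>i. packing_pre_inf X T f s \<epsilon> (C i))"

(* Equals the supremum of all s with infinite packing_measure: finiteness at s forces 0 at every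
   t > s.  The infimum is taken in ereal, so it is \<infinity> for an empty set. *)
definition packing_pressure_at ::
    "(nat \<Rightarrow> 'a metric) \<Rightarrow> (nat \<Rightarrow> 'a \<Rightarrow> 'a) \<Rightarrow> (nat \<Rightarrow> 'a \<Rightarrow> real) \<Rightarrow> 'a set \<Rightarrow> real \<Rightarrow> ereal" where
  "packing_pressure_at X T f Z \<epsilon> = Inf (ereal ` {s. packing_measure X T f s \<epsilon> Z = 0})"

definition packing_pressure ::
    "(nat \<Rightarrow> 'a metric) \<Rightarrow> (nat \<Rightarrow> 'a \<Rightarrow> 'a) \<Rightarrow> (nat \<Rightarrow> 'a \<Rightarrow> real) \<Rightarrow> 'a set \<Rightarrow> ereal" where
  "packing_pressure X T f Z = Lim (at_right 0) (\<lambda>\<epsilon>. packing_pressure_at X T f Z \<epsilon>)"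

end

(* Upper bound.  Let s > P^P(K).  The points of a set C with mu(B_n(x,eps)) < exp(-n s + S_n f(x)) are
   covered by the open balls around a maximal disjoint family of closed n-balls of radius eps/3, so
   their measure is at most exp(-n (s - t)) times a packing sum of exponent t < s.  If the packing
   premeasure of C at t is finite these bounds are summable, and Borel-Cantelli gives a local
   pressure of at most s almost everywhere on C; countably many such C cover K.

   Lower bound.  Let s < P^P(K, eps) and remove from K all points near which K is covered by countably
   many sets of finite premeasure at s.  Near each remaining point there are packings with arbitrarily
   large orders and total weight at least 1, where the node (x,n) has weight exp(-n s + S_n f(x)).
   This yields simple functions g_i from [0,1] to nodes, each refining the previous one, such that
   g_i takes a value with Lebesgue measure at most the weight of that value, which is possible because
   Lebesgue measure has no atoms.  If the refinements are taken close enough to the old centres, the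
   centres converge uniformly to a map h, and each Bowen ball given by a node of g_i, even recentred
   at a nearby point, meets the image under h of only one value set of g_i.  So the image mu of
   Lebesgue measure under h satisfies mu(B_n(x,eps)) <= exp(-n s + S_n f(x) + 1) for infinitely
   many n at mu-almost every x.  Defining mu as an image measure avoids weak limits. *)
theory Submission
  imports Defs
begin

section \<open>Metric continuity, one-sided limits and Borel sets\<close>

lemma metric_continuous_map_of:
  "continuous_map (mtopology_of m) (mtopology_of m') g \<longleftrightarrow>
     g ` mspace m \<subseteq> mspace m' \<and>
     (\<forall>a\<in>mspace m. \<forall>e>0. \<exists>d>0. \<forall>x. x \<in> mspace m \<and> mdist m a x < d \<longrightarrow> mdist m' (g a) (g x) < e)"
  unfolding mtopology_of_def
  by (rule Metric_space.metric_continuous_map) auto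

lemma mdist_self: "x \<in> mspace m \<Longrightarrow> mdist m x x = 0"
  by simp

text \<open>Values of an antitone function grow as the argument falls to 0, so the limit there is a
  supremum. This turns every \<open>Lim (at_right 0)\<close> of the definitions into a
  \<open>SUP\<close> over positive radii.\<close>

lemma tendsto_at_right_SUP:
  fixes g :: "real \<Rightarrow> ereal"
  assumes anti: "\<And>a b. 0 < a \<Longrightarrow> a \<le> b \<Longrightarrow> g b \<le> g a"
  shows "(g \<longlongrightarrow> (SUP e\<in>{0<..}. g e)) (at_right 0)"
proof (rule increasing_tendsto)
  show "\<forall>\<^sub>F e in at_right 0. g e \<le> (SUP e\<in>{0<..}. g e)"
    using eventually_at_right_less[of "0::real"] by eventually_elim (auto intro: SUP_upper)
  fix x assume "x < (SUP e\<in>{0<..}. g e)"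
  then obtain e where e: "0 < e" "x < g e" by (auto simp: less_SUP_iff)
  show "\<forall>\<^sub>F e in at_right 0. x < g e"
    unfolding eventually_at_right_field
  proof (intro exI[of _ e] conjI allI impI)
    fix y assume "0 < y" "y < e"
    then show "x < g y" using anti[of y e] e by auto
  qed (use e in auto)
qed

lemma Lim_at_right_SUP:
  fixes g :: "real \<Rightarrow> ereal"
  assumes "\<And>a b. 0 < a \<Longrightarrow> a \<le> b \<Longrightarrow> g b \<le> g a"
  shows "Lim (at_right 0) g = (SUP e\<in>{0<..}. g e)"
  by (rule tendsto_Lim[OF _ tendsto_at_right_SUP[OF assms]]) auto

lemma log_ext_mono: "0 \<le> a \<Longrightarrow> a \<le> b \<Longrightarrow> log_ext a \<le> log_ext b"
  by (auto simp: log_ext_def)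

text \<open>For \<open>n = 0\<close> the maximum would be over the empty set and have no determined
  value; hence the positivity of the order here and in most later statements.\<close>

lemma bowen_dist_less_iff:
  "n > 0 \<Longrightarrow> bowen_dist X T n x y < e \<longleftrightarrow> (\<forall>j<n. mdist (X j) (iter T j x) (iter T j y) < e)"
  unfolding bowen_dist_def by (subst Max_less_iff) auto

lemma bowen_dist_le_iff:
  "n > 0 \<Longrightarrow> bowen_dist X T n x y \<le> e \<longleftrightarrow> (\<forall>j<n. mdist (X j) (iter T j x) (iter T j y) \<le> e)"
  unfolding bowen_dist_def by (subst Max_le_iff) auto

lemma space_borel_of [simp]: "space (borel_of U) = topspace U"
  unfolding borel_of_def by (rule space_measure_of) (auto dest: openin_subset)

lemma sets_borel_of: "sets (borel_of U) = sigma_sets (topspace U) {A. openin U A}"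
  unfolding borel_of_def by (rule sets_measure_of) (auto dest: openin_subset)

lemma openin_sets_borel_of: "openin U A \<Longrightarrow> A \<in> sets (borel_of U)"
  by (auto simp: sets_borel_of)

lemma closedin_sets_borel_of: "closedin U A \<Longrightarrow> A \<in> sets (borel_of U)"
  using sets.Diff[OF sets.top openin_sets_borel_of[of U "topspace U - A"]]
  by (auto simp: closedin_def double_diff)

text \<open>Closed generators suit the limit map constructed later: its preimage of a closed set is
  a countable intersection of sets given by the approximating maps.\<close>

lemma sets_borel_of_closed: "sets (borel_of U) = sigma_sets (topspace U) {A. closedin U A}"
proof
  have "A \<in> sigma_sets (topspace U) {A. closedin U A}" if "openin U A" for A
    using sigma_sets.Compl[OF sigma_sets.Basic, of "topspace U - A" "{A. closedin U A}" "topspace U"]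
      that openin_subset[OF that] by (auto simp: double_diff)
  then show "sets (borel_of U) \<subseteq> sigma_sets (topspace U) {A. closedin U A}"
    unfolding sets_borel_of by (intro sigma_sets_mono) auto
  show "sigma_sets (topspace U) {A. closedin U A} \<subseteq> sets (borel_of U)"
    using sets.sigma_sets_subset[of "{A. closedin U A}" "borel_of U"] closedin_sets_borel_of by auto
qed

section \<open>Lebesgue measure on the unit interval and its divisibility\<close>

abbreviation unit_lebesgue :: "real measure" where
  "unit_lebesgue \<equiv> restrict_space lborel {0..1}"

lemma prob_space_unit_lebesgue: "prob_space unit_lebesgue"
  by (rule prob_spaceI) (simp add: space_restrict_space emeasure_restrict_space)

interpretation unit: prob_space unit_lebesgue
  by (rule prob_space_unit_lebesgue)

text \<open>The function \<open>F x\<close>, the measure of the part of \<open>A\<close> up to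
  \<open>x\<close>, is 1-Lipschitz on the unit interval and rises from 0 to the measure of
  \<open>A\<close>. The intermediate value theorem yields the place to cut.\<close>

lemma unit_lebesgue_subset_of_measure:
  assumes A: "A \<in> sets unit_lebesgue" and c: "0 \<le> c" "c \<le> measure unit_lebesgue A"
  obtains B where "B \<in> sets unit_lebesgue" "B \<subseteq> A" "measure unit_lebesgue B = c"
proof -
  have meas: "A \<inter> {..x} \<in> sets unit_lebesgue" for x
  proof -
    have "{0..1} \<inter> {..x} \<in> sets unit_lebesgue" by (auto simp: sets_restrict_space)
    moreover have "A \<subseteq> {0..1}" using sets.sets_into_space[OF A] by (simp add: space_restrict_space)
    ultimately show ?thesis using sets.Int[OF A] by (metis Int_assoc inf.absorb_iff1)
  qed
  define F where "F x = measure unit_lebesgue (A \<inter> {..x})" for x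
  have step: "\<bar>F x - F y\<bar> \<le> \<bar>x - y\<bar>" if "x \<le> y" "0 \<le> x" "y \<le> 1" for x y
  proof -
    have I: "{x..y} \<in> sets unit_lebesgue" using that by (auto simp: sets_restrict_space intro!: image_eqI[of _ _ "{x..y}"])
    have "F y \<le> measure unit_lebesgue ((A \<inter> {..x}) \<union> {x..y})"
      unfolding F_def by (rule unit.finite_measure_mono) (use meas I in auto)
    also have "\<dots> \<le> F x + measure unit_lebesgue {x..y}"
      unfolding F_def by (rule measure_Un_le) (use meas I in auto)
    also have "measure unit_lebesgue {x..y} = y - x"
      using that by (subst measure_restrict_space) auto
    finally have "F y \<le> F x + (y - x)" .
    moreover have "F x \<le> F y"
      unfolding F_def by (rule unit.finite_measure_mono) (use meas that in auto)
    ultimately show ?thesis by auto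
  qed
  have cont: "continuous_on {0..1} F"
    unfolding continuous_on_iff
  proof (intro ballI allI impI)
    fix x e :: real assume "x \<in> {0..1}" "0 < e"
    then show "\<exists>d>0. \<forall>x'\<in>{0..1}. dist x' x < d \<longrightarrow> dist (F x') (F x) < e"
      using step[of x] step[of _ x]
      by (intro exI[of _ e]) (smt (verit, best) atLeastAtMost_iff dist_real_def)
  qed
  have sub: "A \<subseteq> {0..1}" using sets.sets_into_space[OF A] by (simp add: space_restrict_space)
  have "F 0 \<le> measure unit_lebesgue {0::real}"
    unfolding F_def using sub by (intro unit.finite_measure_mono) (auto simp: sets_restrict_space intro!: image_eqI[of _ _ "{0}"])
  also have "\<dots> = 0" by (subst measure_restrict_space) auto
  finally have "F 0 \<le> c" using c by simp
  moreover have "F 1 = measure unit_lebesgue A"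
  proof -
    have "A \<inter> {..1} = A" using sub by auto
    then show ?thesis by (simp add: F_def)
  qed
  ultimately obtain x where "F x = c"
    using IVT'[of F 0 c 1] cont c by auto
  with meas show ?thesis by (intro that[of "A \<inter> {..x}"]) (auto simp: F_def)
qed

text \<open>Greedy splitting: cut a piece of measure exactly \<open>w e\<close> off
  \<open>A\<close>, label it \<open>e\<close>, and distribute the rest over the remaining labels. If
  \<open>w e\<close> already suffices for all of \<open>A\<close>, a constant label works. The
  labelling takes values in \<open>E\<close> on all reals, so that its range can be controlled
  later.\<close>

lemma unit_lebesgue_distribute:
  assumes "finite E" "E \<noteq> {}" "A \<in> sets unit_lebesgue" "\<And>e. e \<in> E \<Longrightarrow> 0 \<le> w e"
    and "measure unit_lebesgue A \<le> (\<Sum>e\<in>E. w e)"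
  shows "\<exists>\<phi>. \<phi> \<in> measurable unit_lebesgue (count_space UNIV) \<and> (\<forall>t. \<phi> t \<in> E) \<and>
           (\<forall>e\<in>E. measure unit_lebesgue {t \<in> A. \<phi> t = e} \<le> w e)"
  using assms
proof (induction E arbitrary: A rule: finite_ne_induct)
  case (singleton e)
  then show ?case by (intro exI[of _ "\<lambda>_. e"]) auto
next
  case (insert e F)
  show ?case
  proof (cases "w e \<ge> measure unit_lebesgue A")
    case True
    have "measure unit_lebesgue {t \<in> A. e = e'} \<le> w e'" if "e' \<in> insert e F" for e'
      using True insert.prems that by (cases "e = e'") auto
    then show ?thesis by (intro exI[of _ "\<lambda>_. e"]) auto
  next
    case False
    then obtain B where B: "B \<in> sets unit_lebesgue" "B \<subseteq> A" "measure unit_lebesgue B = w e"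
      using unit_lebesgue_subset_of_measure[of A "w e"] insert.prems by auto
    have "measure unit_lebesgue (A - B) = measure unit_lebesgue A - w e"
      using B insert.prems by (simp add: unit.finite_measure_Diff)
    then have "measure unit_lebesgue (A - B) \<le> (\<Sum>e\<in>F. w e)"
      using insert by simp
    then obtain \<phi> where \<phi>: "\<phi> \<in> measurable unit_lebesgue (count_space UNIV)" "\<And>t. \<phi> t \<in> F"
      "\<And>e. e \<in> F \<Longrightarrow> measure unit_lebesgue {t \<in> A - B. \<phi> t = e} \<le> w e"
      using insert.IH[of "A - B"] insert.prems B by auto
    define \<psi> where "\<psi> t = (if t \<in> B then e else \<phi> t)" for t
    have [measurable]: "\<psi> \<in> measurable unit_lebesgue (count_space UNIV)"
      unfolding \<psi>_def using \<phi>(1) B(1) by measurable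
    have "{t \<in> A. \<psi> t = e} = B" using B(2) \<phi>(2) insert.hyps unfolding \<psi>_def by auto
    moreover have "{t \<in> A. \<psi> t = e'} = {t \<in> A - B. \<phi> t = e'}" if "e' \<in> F" for e'
      using that insert.hyps unfolding \<psi>_def by auto
    ultimately show ?thesis
      using \<phi> B insert.hyps by (intro exI[of _ \<psi>]) (auto simp: \<psi>_def)
  qed
qed

section \<open>Bowen balls\<close>

locale bowen_system =
  fixes X :: "nat \<Rightarrow> 'a metric" and T :: "nat \<Rightarrow> 'a \<Rightarrow> 'a"
  assumes nds: "nds X T"
begin

abbreviation "M \<equiv> mspace (X 0)"
abbreviation "d \<equiv> mdist (X 0)"
abbreviation "\<tau> \<equiv> mtopology_of (X 0)"

lemma openin_\<tau>: "openin \<tau> U \<longleftrightarrow> U \<subseteq> M \<and> (\<forall>x\<in>U. \<exists>r>0. \<forall>y\<in>M. d x y < r \<longrightarrow> y \<in> U)"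
proof -
  interpret Metric_space M d by auto
  show ?thesis
    unfolding mtopology_of_def openin_mtopology subset_iff in_mball by blast
qed

lemma continuous_iter: "continuous_map \<tau> (mtopology_of (X j)) (iter T j)"
proof (induction j)
  case (Suc j)
  moreover have "continuous_map (mtopology_of (X j)) (mtopology_of (X (Suc j))) (T j)"
    using nds by (simp add: nds_def)
  ultimately show ?case
    by (simp only: iter.simps) (rule continuous_map_compose)
qed auto

lemma iter_mem: "x \<in> M \<Longrightarrow> iter T j x \<in> mspace (X j)"
  using continuous_map_image_subset_topspace[OF continuous_iter[of j]] by auto

text \<open>Only finitely many iterates occur, so the minimum of their continuity moduli
  works.\<close>

lemma iter_close:
  assumes x: "x \<in> M" and "\<eta> > 0"
  shows "\<exists>\<delta>>0. \<forall>z\<in>M. d x z < \<delta> \<longrightarrow> (\<forall>j<n. mdist (X j) (iter T j x) (iter T j z) < \<eta>)"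
proof (induction n)
  case (Suc n)
  then obtain a where a: "a > 0" "\<forall>z\<in>M. d x z < a \<longrightarrow> (\<forall>j<n. mdist (X j) (iter T j x) (iter T j z) < \<eta>)"
    by auto
  obtain b where b: "b > 0" "\<forall>z. z \<in> M \<and> d x z < b \<longrightarrow> mdist (X n) (iter T n x) (iter T n z) < \<eta>"
    using continuous_iter[of n] assms unfolding metric_continuous_map_of by metis
  show ?case
    using a b by (intro exI[of _ "min a b"]) (auto simp: less_Suc_eq)
qed (auto intro: exI[of _ 1])

lemma mem_bowen_ball:
  "n > 0 \<Longrightarrow> y \<in> bowen_ball X T n x e \<longleftrightarrow> y \<in> M \<and> (\<forall>j<n. mdist (X j) (iter T j x) (iter T j y) < e)"
  by (simp add: bowen_ball_def bowen_dist_less_iff)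

lemma mem_bowen_cball:
  "n > 0 \<Longrightarrow> y \<in> bowen_cball X T n x e \<longleftrightarrow> y \<in> M \<and> (\<forall>j<n. mdist (X j) (iter T j x) (iter T j y) \<le> e)"
  by (simp add: bowen_cball_def bowen_dist_le_iff)

lemma openin_bowen_ball:
  assumes x: "x \<in> M" and n: "n > 0"
  shows "openin \<tau> (bowen_ball X T n x e)"
  unfolding openin_\<tau>
proof (intro conjI ballI)
  show "bowen_ball X T n x e \<subseteq> M" by (auto simp: bowen_ball_def)
  fix y assume y: "y \<in> bowen_ball X T n x e"
  then have yM: "y \<in> M" and lt: "bowen_dist X T n x y < e" by (auto simp: bowen_ball_def)
  \<comment> \<open>The strict inequality leaves the slack \<open>e - D\<close>, which is the
    displacement allowed to each iterate of \<open>y\<close>.\<close>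
  define D where "D = bowen_dist X T n x y"
  have D: "\<forall>j<n. mdist (X j) (iter T j x) (iter T j y) \<le> D"
    using bowen_dist_le_iff[OF n, of X T x y D] by (simp add: D_def)
  obtain r where r: "r > 0" "\<forall>z\<in>M. d y z < r \<longrightarrow> (\<forall>j<n. mdist (X j) (iter T j y) (iter T j z) < e - D)"
    using iter_close[OF yM, of "e - D" n] lt by (auto simp: D_def)
  show "\<exists>r>0. \<forall>z\<in>M. d y z < r \<longrightarrow> z \<in> bowen_ball X T n x e"
  proof (intro exI[of _ r] conjI ballI impI r)
    fix z assume z: "z \<in> M" "d y z < r"
    have "mdist (X j) (iter T j x) (iter T j z) < e" if "j < n" for j
      using mdist_triangle[of "iter T j x" "X j" "iter T j y" "iter T j z"] iter_mem x yM z D r that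
      by (smt (verit))
    then show "z \<in> bowen_ball X T n x e" using n z by (auto simp: mem_bowen_ball)
  qed
qed

lemma bowen_ball_measurable:
  "\<mu> \<in> borel_probs (X 0) \<Longrightarrow> x \<in> M \<Longrightarrow> n > 0 \<Longrightarrow> bowen_ball X T n x e \<in> sets \<mu>"
  using openin_sets_borel_of[OF openin_bowen_ball] by (auto simp: borel_probs_def)

text \<open>A Vitali-type selection. Finitely many open balls of radius \<open>e/3\<close> cover the
  compact space, and their number bounds the size of every disjoint family of closed
  \<open>e/3\<close>-balls; a family of largest cardinality is therefore available, and its
  maximality gives the cover.\<close>

lemma finite_packing_cover:
  assumes A: "A \<subseteq> M" and n: "n > 0" and e: "e > 0"
  obtains E where "finite E" "E \<subseteq> A" "disjoint_family_on (\<lambda>x. bowen_cball X T n x (e/3)) E"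
    "A \<subseteq> (\<Union>x\<in>E. bowen_ball X T n x e)"
proof -
  let ?sep = "\<lambda>E. E \<subseteq> A \<and> finite E \<and> disjoint_family_on (\<lambda>x. bowen_cball X T n x (e/3)) E"
  have self: "x \<in> bowen_ball X T n x (e/3)" if "x \<in> M" for x
    using that e n by (auto simp: mem_bowen_ball mdist_self iter_mem)
  have "compactin \<tau> M"
    using nds by (simp add: nds_def compact_space_def flip: topspace_mtopology_of)
  moreover have "\<forall>U\<in>(\<lambda>x. bowen_ball X T n x (e/3)) ` M. openin \<tau> U"
    using openin_bowen_ball[OF _ n] by blast
  moreover have "M \<subseteq> \<Union> ((\<lambda>x. bowen_ball X T n x (e/3)) ` M)"
    using self by blast
  ultimately obtain \<C> where \<C>: "finite \<C>" "\<C> \<subseteq> (\<lambda>x. bowen_ball X T n x (e/3)) ` M" "M \<subseteq> \<Union>\<C>"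
    unfolding compactin_def by meson
  have bound: "card E \<le> card \<C>" if E: "?sep E" for E
  proof -
    have "\<forall>x\<in>E. \<exists>c\<in>\<C>. x \<in> c" using E \<C>(3) A by blast
    then obtain c where c: "\<And>x. x \<in> E \<Longrightarrow> c x \<in> \<C> \<and> x \<in> c x" by metis
    have "inj_on c E"
    proof
      fix x y assume xy: "x \<in> E" "y \<in> E" "c x = c y"
      obtain z where z: "z \<in> M" "c x = bowen_ball X T n z (e/3)" using c[OF xy(1)] \<C>(2) by auto
      \<comment> \<open>Two centres assigned to the same covering ball would both have its centre
        \<open>z\<close> in their closed balls.\<close>
      have "z \<in> bowen_cball X T n x (e/3)" "z \<in> bowen_cball X T n y (e/3)"
        using c[OF xy(1)] c[OF xy(2)] z n xy(3)
        by (auto simp: mem_bowen_ball mem_bowen_cball mdist_commute intro: less_imp_le)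
      then show "x = y" using E xy unfolding disjoint_family_on_def by blast
    qed
    then show ?thesis using c \<C>(1) by (intro card_inj_on_le[of c]) auto
  qed
  obtain E where E: "?sep E" and max: "\<And>F. ?sep F \<Longrightarrow> card F \<le> card E"
  proof -
    have "?sep {}" by (simp add: disjoint_family_on_def)
    moreover have "\<forall>F. ?sep F \<longrightarrow> card F < Suc (card \<C>)" using bound by (simp add: less_Suc_eq_le)
    ultimately have "\<exists>E. ?sep E \<and> (\<forall>F. ?sep F \<longrightarrow> card F \<le> card E)"
      by (rule ex_has_greatest_nat)
    then show ?thesis using that by blast
  qed
  have "x \<in> (\<Union>x\<in>E. bowen_ball X T n x e)" if x: "x \<in> A" for x
  proof (rule ccontr)
    assume no: "x \<notin> (\<Union>x\<in>E. bowen_ball X T n x e)"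
    have xM: "x \<in> M" using x A by auto
    have "x \<notin> E"
      using no n e xM by (auto simp: mem_bowen_ball mdist_self iter_mem)
    \<comment> \<open>If the two closed balls met, the centres would be at Bowen distance at most
      \<open>2*e/3\<close>, and \<open>x\<close> would be covered after all.\<close>
    moreover have "bowen_cball X T n x (e/3) \<inter> bowen_cball X T n y (e/3) = {}" if y: "y \<in> E" for y
    proof (rule ccontr)
      assume "\<not> ?thesis"
      then obtain z where z: "z \<in> M"
        "\<forall>j<n. mdist (X j) (iter T j x) (iter T j z) \<le> e/3" "\<forall>j<n. mdist (X j) (iter T j y) (iter T j z) \<le> e/3"
        using n by (auto simp: mem_bowen_cball)
      have yM: "y \<in> M" using y E A by auto
      have "mdist (X j) (iter T j y) (iter T j x) < e" if "j < n" for j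
      proof -
        have "mdist (X j) (iter T j y) (iter T j x)
            \<le> mdist (X j) (iter T j y) (iter T j z) + mdist (X j) (iter T j z) (iter T j x)"
          by (rule mdist_triangle) (use xM yM z(1) iter_mem in auto)
        moreover have "mdist (X j) (iter T j y) (iter T j z) \<le> e/3" using z(3) that by auto
        moreover have "mdist (X j) (iter T j z) (iter T j x) \<le> e/3"
          using z(2) that by (subst mdist_commute) auto
        ultimately show ?thesis using e by linarith
      qed
      then have "x \<in> bowen_ball X T n y e" using n xM by (auto simp: mem_bowen_ball)
      then show False using no y by auto
    qed
    ultimately have "?sep (insert x E)"
      using E x by (auto simp: disjoint_family_on_insert)
    from max[OF this] \<open>x \<notin> E\<close> E show False by auto
  qed
  then show ?thesis using that E by blast
qed

end

section \<open>Packings\<close>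

locale bowen_potential = bowen_system X T
  for X :: "nat \<Rightarrow> 'a metric" and T :: "nat \<Rightarrow> 'a \<Rightarrow> 'a" +
  fixes f :: "nat \<Rightarrow> 'a \<Rightarrow> real"
  assumes continuous: "continuous_seq X f"
begin

text \<open>A pair \<open>(x, n)\<close> stands for a Bowen ball of order \<open>n\<close> centred at \<open>x\<close>.\<close>
definition weight :: "real \<Rightarrow> 'a \<times> nat \<Rightarrow> real" where
  "weight s p = exp (- real (snd p) * s + birkhoff_sum T f (snd p) (fst p))"

definition node_ball :: "real \<Rightarrow> 'a \<times> nat \<Rightarrow> 'a set" where
  "node_ball e p = bowen_cball X T (snd p) (fst p) e"

lemma weight_nonneg [simp]: "0 \<le> weight s p"
  by (simp add: weight_def)

lemma weight_pos: "0 < weight s p"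
  by (simp add: weight_def)

lemma packing_mono:
  assumes "packing X T N e Z I n x" "N' \<le> N" "e' \<le> e" "I' \<subseteq> I"
  shows "packing X T N' e' Z I' n x"
proof -
  have "bowen_cball X T (n i) (x i) e' \<subseteq> bowen_cball X T (n i) (x i) e" for i
    using assms(3) by (auto simp: bowen_cball_def)
  then have "bowen_cball X T (n i) (x i) e' \<inter> bowen_cball X T (n j) (x j) e' = {}"
    if "i \<in> I'" "j \<in> I'" "i \<noteq> j" for i j
    using assms(1,4) that unfolding packing_def disjoint_family_on_def by blast
  moreover have "x i \<in> Z \<and> N' \<le> n i" if "i \<in> I'" for i
    using assms(1,2,4) that unfolding packing_def by (auto intro: order_trans)
  ultimately show ?thesis
    unfolding packing_def disjoint_family_on_def by blast
qed

lemma packing_pre_antimono: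
  assumes "N' \<le> N" "e' \<le> e"
  shows "packing_pre X T f s N e Z \<le> packing_pre X T f s N' e' Z"
  unfolding packing_pre_def by (rule SUP_subset_mono) (use assms packing_mono in auto)

text \<open>Raising \<open>N\<close> leaves fewer packings, so the limit is a decreasing
  one.\<close>

lemma packing_pre_inf_eq: "packing_pre_inf X T f s e Z = (INF N. packing_pre X T f s N e Z)"
  unfolding packing_pre_inf_def
  by (intro limI LIMSEQ_INF) (auto simp: decseq_def intro: packing_pre_antimono)

lemma packing_pre_inf_antimono:
  "e' \<le> e \<Longrightarrow> packing_pre_inf X T f s e Z \<le> packing_pre_inf X T f s e' Z"
  unfolding packing_pre_inf_eq by (intro INF_mono) (auto intro: packing_pre_antimono)

lemma packing_pressure_at_antimono:
  assumes "e' \<le> e"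
  shows "packing_pressure_at X T f Z e \<le> packing_pressure_at X T f Z e'"
proof -
  have "packing_measure X T f s e Z \<le> packing_measure X T f s e' Z" for s
    unfolding packing_measure_def
    by (intro INF_mono bexI) (auto intro!: suminf_le packing_pre_inf_antimono assms)
  then have "packing_measure X T f s e' Z = 0 \<Longrightarrow> packing_measure X T f s e Z = 0" for s
    by (metis le_zero_eq)
  then show ?thesis
    unfolding packing_pressure_at_def by (intro Inf_superset_mono) auto
qed

lemma packing_pressure_eq: "packing_pressure X T f Z = (SUP e\<in>{0<..}. packing_pressure_at X T f Z e)"
  unfolding packing_pressure_def by (intro Lim_at_right_SUP packing_pressure_at_antimono)

lemma node_mem_node_ball: "fst p \<in> M \<Longrightarrow> 0 \<le> e \<Longrightarrow> 0 < snd p \<Longrightarrow> fst p \<in> node_ball e p"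
  by (simp add: node_ball_def mem_bowen_cball mdist_self iter_mem)

text \<open>Passes from indexed countable packings to finite sets of nodes: an infinite sum of
  nonnegative terms is the supremum of its finite partial sums. From here on packings are handled
  only through this form.\<close>

lemma packing_pre_le_iff:
  assumes N: "N > 0" and Z: "Z \<subseteq> M" and e: "e \<ge> 0"
  shows "packing_pre X T f s N e Z \<le> B \<longleftrightarrow>
    (\<forall>E. finite E \<and> E \<subseteq> Z \<times> {N..} \<and> disjoint_family_on (node_ball e) E \<longrightarrow>
         ennreal (\<Sum>p\<in>E. weight s p) \<le> B)" (is "?L \<longleftrightarrow> ?R")
proof
  assume L: ?L
  show ?R
  proof (intro allI impI, elim conjE)
    fix E assume E: "finite E" "E \<subseteq> Z \<times> {N..}" "disjoint_family_on (node_ball e) E"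
    obtain h where h: "bij_betw h {0..<card E} E"
      using ex_bij_betw_nat_finite[OF E(1)] by auto
    have hE: "h i \<in> E" if "i \<in> {0..<card E}" for i
      using h that by (auto simp: bij_betw_def)
    have "packing X T N e Z {0..<card E} (snd \<circ> h) (fst \<circ> h)"
      unfolding packing_def
    proof (intro conjI ballI)
      fix i assume "i \<in> {0..<card E}"
      then show "(fst \<circ> h) i \<in> Z" "N \<le> (snd \<circ> h) i"
        using subsetD[OF E(2) hE[of i]] by (auto simp: mem_Times_iff)
    next
      show "disjoint_family_on (\<lambda>i. bowen_cball X T ((snd \<circ> h) i) ((fst \<circ> h) i) e) {0..<card E}"
        using E(3) hE bij_betw_imp_inj_on[OF h]
        unfolding disjoint_family_on_def inj_on_def node_ball_def by (metis comp_apply)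
    qed
    then have "(\<Sum>\<^sub>\<infinity>i\<in>{0..<card E}. ennreal (exp (- real ((snd \<circ> h) i) * s + birkhoff_sum T f ((snd \<circ> h) i) ((fst \<circ> h) i))))
       \<le> packing_pre X T f s N e Z"
      unfolding packing_pre_def by (intro SUP_upper2[of "({0..<card E}, snd \<circ> h, fst \<circ> h)"]) auto
    also have "(\<Sum>\<^sub>\<infinity>i\<in>{0..<card E}. ennreal (exp (- real ((snd \<circ> h) i) * s + birkhoff_sum T f ((snd \<circ> h) i) ((fst \<circ> h) i))))
       = ennreal (\<Sum>i\<in>{0..<card E}. weight s (h i))"
      by (simp add: weight_def sum_ennreal)
    also have "(\<Sum>i\<in>{0..<card E}. weight s (h i)) = (\<Sum>p\<in>E. weight s p)"
      by (rule sum.reindex_bij_betw[OF h])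
    finally show "ennreal (\<Sum>p\<in>E. weight s p) \<le> B" using L by simp
  qed
next
  assume R: ?R
  have "(\<Sum>\<^sub>\<infinity>i\<in>I. ennreal (exp (- real (n i) * s + birkhoff_sum T f (n i) (x i)))) \<le> B"
    if pk: "packing X T N e Z I n x" for I n x
  proof (subst nonneg_infsum_complete, simp, rule SUP_least)
    fix F assume F: "F \<in> {F. finite F \<and> F \<subseteq> I}"
    define h where "h i = (x i, n i)" for i
    have hM: "fst (h i) \<in> M" "0 < snd (h i)" if "i \<in> F" for i
      using pk that F Z N unfolding packing_def h_def by fastforce+
    have dis: "node_ball e (h i) \<inter> node_ball e (h j) = {}" if "i \<in> F" "j \<in> F" "i \<noteq> j" for i j
      using pk that F unfolding packing_def disjoint_family_on_def h_def node_ball_def by auto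
    \<comment> \<open>Each ball contains its centre, so disjoint balls come from distinct nodes and
      no summand is lost when the indices are replaced by the image set.\<close>
    have inj: "inj_on h F"
      using dis node_mem_node_ball[OF hM(1) e hM(2)] by (fastforce simp: inj_on_def)
    have "ennreal (\<Sum>p\<in>h ` F. weight s p) \<le> B"
    proof (rule R[rule_format], intro conjI)
      show "h ` F \<subseteq> Z \<times> {N..}" using pk F unfolding packing_def h_def by auto
      show "disjoint_family_on (node_ball e) (h ` F)"
        using dis unfolding disjoint_family_on_def by blast
    qed (use F in auto)
    then show "(\<Sum>i\<in>F. ennreal (exp (- real (n i) * s + birkhoff_sum T f (n i) (x i)))) \<le> B"
      by (subst (asm) sum.reindex[OF inj]) (simp add: weight_def h_def sum_ennreal)
  qed
  then show ?L unfolding packing_pre_def by (intro SUP_least) auto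
qed

lemma packing_pre_upper:
  assumes "N > 0" "Z \<subseteq> M" "e \<ge> 0" "finite E" "E \<subseteq> Z \<times> {N..}" "disjoint_family_on (node_ball e) E"
  shows "ennreal (\<Sum>p\<in>E. weight s p) \<le> packing_pre X T f s N e Z"
  using packing_pre_le_iff[of N Z e s "packing_pre X T f s N e Z"] assms by auto

text \<open>Working with this \<open>\<sigma>\<close>-ideal instead of \<open>packing_measure\<close> loses nothing: changing
  the exponent by any positive amount turns a finite premeasure into zero.\<close>
definition packing_sigma_finite :: "real \<Rightarrow> real \<Rightarrow> 'a set \<Rightarrow> bool" where
  "packing_sigma_finite s e A \<longleftrightarrow>
     (\<exists>C::nat \<Rightarrow> 'a set. (\<forall>i. C i \<subseteq> M) \<and> A \<subseteq> (\<Union>i. C i) \<and> (\<forall>i. packing_pre_inf X T f s e (C i) < \<infinity>))"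

lemma packing_sigma_finite_if_measure_zero:
  assumes "packing_measure X T f s e A = 0"
  shows "packing_sigma_finite s e A"
proof -
  have "packing_measure X T f s e A < \<infinity>" using assms by simp
  then obtain C where C: "\<And>i. C i \<subseteq> M" "A \<subseteq> (\<Union>i. C i)"
    "(\<Sum>i. packing_pre_inf X T f s e (C i)) < \<infinity>"
    unfolding packing_measure_def INF_less_iff by auto
  have "packing_pre_inf X T f s e (C i) \<le> (\<Sum>i. packing_pre_inf X T f s e (C i))" for i
    using sum_le_suminf[of "\<lambda>i. packing_pre_inf X T f s e (C i)" "{i}"] by simp
  with C show ?thesis unfolding packing_sigma_finite_def by (meson le_less_trans)
qed

text \<open>All orders are at least \<open>N\<close>, so raising the exponent shrinks each summand
  by at least the factor \<open>exp (- real N * (t - s))\<close>.\<close>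

lemma packing_pre_exponent:
  assumes "s < t" "N > 0" "Z \<subseteq> M" "e \<ge> 0"
  shows "packing_pre X T f t N e Z \<le> ennreal (exp (- real N * (t - s))) * packing_pre X T f s N e Z"
  unfolding packing_pre_le_iff[OF assms(2-4)]
proof (intro allI impI, elim conjE)
  fix E assume E: "finite E" "E \<subseteq> Z \<times> {N..}" "disjoint_family_on (node_ball e) E"
  have w: "weight t p \<le> exp (- real N * (t - s)) * weight s p" if "p \<in> E" for p
  proof -
    have "real N * (t - s) \<le> real (snd p) * (t - s)"
      using subsetD[OF E(2) that] assms by (intro mult_right_mono) (auto simp: mem_Times_iff)
    then show ?thesis unfolding weight_def by (simp add: algebra_simps flip: exp_add)
  qed
  have "(\<Sum>p\<in>E. weight t p) \<le> exp (- real N * (t - s)) * (\<Sum>p\<in>E. weight s p)"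
    unfolding sum_distrib_left by (rule sum_mono) (rule w)
  then have "ennreal (\<Sum>p\<in>E. weight t p) \<le> ennreal (exp (- real N * (t - s))) * ennreal (\<Sum>p\<in>E. weight s p)"
    by (simp add: sum_nonneg flip: ennreal_mult)
  also have "\<dots> \<le> ennreal (exp (- real N * (t - s))) * packing_pre X T f s N e Z"
    by (intro mult_left_mono packing_pre_upper assms E) simp
  finally show "ennreal (\<Sum>p\<in>E. weight t p) \<le> ennreal (exp (- real N * (t - s))) * packing_pre X T f s N e Z" .
qed

lemma packing_pre_inf_finiteD:
  assumes "packing_pre_inf X T f s e Z < \<infinity>"
  obtains N0 B where "N0 > 0" "0 \<le> B" "\<And>N. N \<ge> N0 \<Longrightarrow> packing_pre X T f s N e Z \<le> ennreal B"
proof -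
  obtain N where N: "packing_pre X T f s N e Z < \<infinity>"
    using assms unfolding packing_pre_inf_eq INF_less_iff by auto
  define B where "B = enn2real (packing_pre X T f s N e Z)"
  have B: "packing_pre X T f s N e Z = ennreal B" "0 \<le> B" using N unfolding B_def by auto
  show ?thesis
  proof (rule that[of "Suc N" B])
    fix N' assume "Suc N \<le> N'"
    then show "packing_pre X T f s N' e Z \<le> ennreal B"
      using packing_pre_antimono[of N N' e e s Z] B by simp
  qed (use B in auto)
qed

text \<open>The premeasures at \<open>s\<close> stay below one constant \<open>B\<close> for large
  \<open>N\<close>, while the factor from \<open>packing_pre_exponent\<close> tends to 0.\<close>

lemma packing_pre_inf_zero:
  assumes "packing_pre_inf X T f s e Z < \<infinity>" "s < t" "Z \<subseteq> M" "e \<ge> 0"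
  shows "packing_pre_inf X T f t e Z = 0"
proof -
  obtain N0 B where N0: "N0 > 0" "0 \<le> B" and B: "\<And>N. N \<ge> N0 \<Longrightarrow> packing_pre X T f s N e Z \<le> ennreal B"
    using packing_pre_inf_finiteD[OF assms(1)] by blast
  have "packing_pre_inf X T f t e Z \<le> ennreal (exp (- real N * (t - s)) * B)" if N: "N \<ge> N0" for N
  proof -
    have "packing_pre_inf X T f t e Z \<le> packing_pre X T f t N e Z"
      unfolding packing_pre_inf_eq by (rule INF_lower) simp
    also have "\<dots> \<le> ennreal (exp (- real N * (t - s))) * packing_pre X T f s N e Z"
      using N N0 assms by (intro packing_pre_exponent) auto
    also have "\<dots> \<le> ennreal (exp (- real N * (t - s))) * ennreal B"
      by (intro mult_left_mono B N) simp
    finally show ?thesis by (simp add: ennreal_mult N0)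
  qed
  moreover have "(\<lambda>N. ennreal (exp (- real N * (t - s)) * B)) \<longlonglongrightarrow> ennreal 0"
  proof (rule tendsto_ennrealI)
    have "(\<lambda>N. exp (- (t - s)) ^ N * B) \<longlonglongrightarrow> 0 * B"
      by (intro tendsto_mult LIMSEQ_power_zero tendsto_const) (use assms in auto)
    moreover have "exp (- (t - s)) ^ N = exp (- real N * (t - s))" for N
      by (subst exp_of_nat_mult[symmetric]) (simp add: algebra_simps)
    ultimately show "(\<lambda>N. exp (- real N * (t - s)) * B) \<longlonglongrightarrow> 0"
      by simp
  qed
  ultimately have "packing_pre_inf X T f t e Z \<le> ennreal 0"
    by (intro LIMSEQ_le_const[where X = "\<lambda>N. ennreal (exp (- real N * (t - s)) * B)"]) auto
  then show ?thesis by simp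
qed

text \<open>The cover with finite premeasures at \<open>s\<close> has zero premeasures at
  \<open>s + r\<close> for every \<open>r > 0\<close>. Used in contrapositive form: a pressure above
  \<open>s\<close> makes the set not sigma-finite at \<open>s\<close>.\<close>

lemma packing_pressure_at_le:
  assumes "packing_sigma_finite s e A" "e \<ge> 0"
  shows "packing_pressure_at X T f A e \<le> ereal s"
proof (rule ereal_le_epsilon2)
  fix r :: real assume r: "0 < r"
  obtain C :: "nat \<Rightarrow> 'a set" where C: "\<And>i. C i \<subseteq> M" "A \<subseteq> (\<Union>i. C i)" "\<And>i. packing_pre_inf X T f s e (C i) < \<infinity>"
    using assms unfolding packing_sigma_finite_def by blast
  have "packing_measure X T f (s + r) e A \<le> (\<Sum>i. packing_pre_inf X T f (s + r) e (C i))"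
    unfolding packing_measure_def
  proof (rule INF_lower)
    show "C \<in> {C. (\<forall>i. C i \<subseteq> M) \<and> A \<subseteq> (\<Union>i. C i)}" using C(1,2) by blast
  qed
  also have "\<dots> = 0" using packing_pre_inf_zero[OF C(3) _ C(1) assms(2), of "s + r"] r by simp
  finally show "packing_pressure_at X T f A e \<le> ereal s + ereal r"
    unfolding packing_pressure_at_def by (intro Inf_lower) auto
qed

lemma packing_sigma_finite_subset:
  "packing_sigma_finite s e A \<Longrightarrow> B \<subseteq> A \<Longrightarrow> packing_sigma_finite s e B"
  unfolding packing_sigma_finite_def by (meson subset_trans)

lemma packing_sigma_finite_UN_nat:
  assumes "\<And>i::nat. packing_sigma_finite s e (A i)"
  shows "packing_sigma_finite s e (\<Union>i. A i)"
proof -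
  have "\<forall>i. \<exists>C::nat \<Rightarrow> 'a set. (\<forall>j. C j \<subseteq> M) \<and> A i \<subseteq> (\<Union>j. C j) \<and>
      (\<forall>j. packing_pre_inf X T f s e (C j) < \<infinity>)"
    using assms unfolding packing_sigma_finite_def by blast
  from choice[OF this] obtain C :: "nat \<Rightarrow> nat \<Rightarrow> 'a set" where C: "\<And>i j. C i j \<subseteq> M" "\<And>i. A i \<subseteq> (\<Union>j. C i j)"
      "\<And>i j. packing_pre_inf X T f s e (C i j) < \<infinity>"
    by blast
  have "x \<in> (\<Union>k. case_prod C (prod_decode k))" if x: "x \<in> A i" for x i
  proof -
    obtain j where "x \<in> C i j" using x C(2) by blast
    then show ?thesis by (intro UN_I[of "prod_encode (i, j)"]) auto
  qed
  then have "(\<Union>i. A i) \<subseteq> (\<Union>k. case_prod C (prod_decode k))" by blast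
  then show ?thesis
    unfolding packing_sigma_finite_def
    using C by (intro exI[of _ "\<lambda>k. case_prod C (prod_decode k)"]) (auto split: prod.split)
qed

lemma packing_sigma_finite_empty: "packing_sigma_finite s e {}"
proof -
  have "packing_pre X T f s 0 e {} = 0"
    by (auto simp: packing_pre_def packing_def bot_ennreal[symmetric] intro!: SUP_eqI)
  then have "packing_pre_inf X T f s e {} \<le> 0"
    unfolding packing_pre_inf_eq by (metis INF_lower UNIV_I)
  then show ?thesis
    unfolding packing_sigma_finite_def by (intro exI[of _ "\<lambda>_. {}"]) auto
qed

lemma packing_sigma_finite_UN:
  assumes "countable J" "\<And>j. j \<in> J \<Longrightarrow> packing_sigma_finite s e (A j)"
  shows "packing_sigma_finite s e (\<Union>j\<in>J. A j)"
proof (cases "J = {}")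
  case False
  have "packing_sigma_finite s e (\<Union>i. A (from_nat_into J i))"
    by (rule packing_sigma_finite_UN_nat) (use assms from_nat_into[OF False] in auto)
  then show ?thesis
    by (rule packing_sigma_finite_subset)
      (use from_nat_into_surj[OF assms(1)] in \<open>force\<close>)
qed (use packing_sigma_finite_empty in auto)

end

section \<open>Local pressure and the upper bound\<close>

text \<open>Dropping the negative part only increases the value. The nonnegative integral is a
  supremum over simple functions and hence monotone for arbitrary integrands, which is how a local
  pressure of unknown measurability is handled. For \<open>t \<ge> 0\<close> the passage through
  \<open>ennreal\<close> preserves \<open>t\<close>.\<close>

lemma ereal_integral_le:
  assumes "prob_space \<mu>" "0 \<le> t" "AE x in \<mu>. g x \<le> ereal t"
  shows "ereal_integral \<mu> g \<le> ereal t"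
proof -
  interpret prob_space \<mu> by fact
  have "AE x in \<mu>. e2ennreal (g x) \<le> ennreal t"
    using assms(3) by eventually_elim (simp add: e2ennreal_mono flip: e2ennreal_ereal)
  then have "(\<integral>\<^sup>+ x. e2ennreal (g x) \<partial>\<mu>) \<le> (\<integral>\<^sup>+ x. ennreal t \<partial>\<mu>)"
    by (rule nn_integral_mono_AE)
  also have "\<dots> = ennreal t" by (simp add: emeasure_space_1)
  finally have "enn2ereal (\<integral>\<^sup>+ x. e2ennreal (g x) \<partial>\<mu>) \<le> ereal t"
    using assms(2) by (metis enn2ereal_ennreal less_eq_ennreal.rep_eq)
  then show ?thesis
    unfolding ereal_integral_def by (rule ereal_diff_le_mono_left) simp
qed

lemma ereal_integral_ge:
  assumes "prob_space \<mu>" "0 \<le> t" "AE x in \<mu>. ereal t \<le> g x"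
  shows "ereal t \<le> ereal_integral \<mu> g"
proof -
  interpret prob_space \<mu> by fact
  have "ennreal t = (\<integral>\<^sup>+ x. ennreal t \<partial>\<mu>)" by (simp add: emeasure_space_1)
  also have "\<dots> \<le> (\<integral>\<^sup>+ x. e2ennreal (g x) \<partial>\<mu>)"
    using assms(3) by (intro nn_integral_mono_AE, eventually_elim)
      (simp add: e2ennreal_mono flip: e2ennreal_ereal)
  finally have pos: "ereal t \<le> enn2ereal (\<integral>\<^sup>+ x. e2ennreal (g x) \<partial>\<mu>)"
    using assms(2) by (metis enn2ereal_ennreal less_eq_ennreal.rep_eq)
  \<comment> \<open>Nonnegativity of \<open>t\<close> makes the negative part vanish almost
    everywhere, so the subtraction is harmless.\<close>
  have "AE x in \<mu>. e2ennreal (- g x) = 0"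
    using assms(3)
  proof eventually_elim
    case (elim x)
    have "- g x \<le> - ereal t" using elim by (simp only: ereal_minus_le_minus)
    also have "\<dots> \<le> 0" using assms(2) by simp
    finally show ?case by (rule e2ennreal_neg)
  qed
  then have "(\<integral>\<^sup>+ x. e2ennreal (- g x) \<partial>\<mu>) = (\<integral>\<^sup>+ x. 0 \<partial>\<mu>)"
    by (rule nn_integral_cong_AE)
  with pos show ?thesis
    unfolding ereal_integral_def by (simp add: zero_ennreal.rep_eq)
qed

context bowen_potential
begin

definition local_pressure_at :: "'a measure \<Rightarrow> 'a \<Rightarrow> real \<Rightarrow> ereal" where
  "local_pressure_at \<mu> x e = limsup (\<lambda>n.
     (- log_ext (measure \<mu> (bowen_ball X T n x e)) + ereal (birkhoff_sum T f n x)) / ereal (real n))"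

lemma local_pressure_at_antimono:
  assumes \<mu>: "\<mu> \<in> borel_probs (X 0)" and x: "x \<in> M" and "a \<le> b"
  shows "local_pressure_at \<mu> x b \<le> local_pressure_at \<mu> x a"
  unfolding local_pressure_at_def
proof (rule Limsup_mono)
  interpret prob_space \<mu> using \<mu> by (simp add: borel_probs_def)
  show "\<forall>\<^sub>F n in sequentially.
     (- log_ext (measure \<mu> (bowen_ball X T n x b)) + ereal (birkhoff_sum T f n x)) / ereal (real n)
     \<le> (- log_ext (measure \<mu> (bowen_ball X T n x a)) + ereal (birkhoff_sum T f n x)) / ereal (real n)"
    \<comment> \<open>Order 0, where the Bowen ball is undetermined and the divisor is 0, does not
      affect the limsup.\<close>
    using eventually_gt_at_top[of 0]
  proof eventually_elim
    case (elim n)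
    have "bowen_ball X T n x a \<subseteq> bowen_ball X T n x b"
      using \<open>a \<le> b\<close> by (auto simp: bowen_ball_def)
    then have "measure \<mu> (bowen_ball X T n x a) \<le> measure \<mu> (bowen_ball X T n x b)"
      using bowen_ball_measurable[OF \<mu> x elim] by (intro finite_measure_mono)
    then show ?case
      using elim by (intro ereal_divide_right_mono add_right_mono) (simp_all add: log_ext_mono)
  qed
qed

lemma upper_local_pressure_eq:
  assumes "\<mu> \<in> borel_probs (X 0)" "x \<in> M"
  shows "upper_local_pressure X T f \<mu> x = (SUP e\<in>{0<..}. local_pressure_at \<mu> x e)"
  using Lim_at_right_SUP[of "local_pressure_at \<mu> x"] local_pressure_at_antimono[OF assms]
  unfolding upper_local_pressure_def local_pressure_at_def by blast

text \<open>The set of points with a small ball is not known to be measurable, so the bound is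
  stated for a measurable superset \<open>U\<close>, the finite union of covering balls. All nodes
  have the same order \<open>n\<close>, so passing from \<open>weight t\<close> to
  \<open>weight s\<close> costs exactly one exponential factor.\<close>

lemma ball_measure_bound:
  assumes \<mu>: "\<mu> \<in> borel_probs (X 0)" and C: "C \<subseteq> M" and e: "e > 0" and n: "n > 0" and B: "B \<ge> 0"
    and bnd: "packing_pre X T f s n (e/3) C \<le> ennreal B"
  shows "\<exists>U\<in>sets \<mu>. {x\<in>C. measure \<mu> (bowen_ball X T n x e) < weight t (x, n)} \<subseteq> U \<and>
    measure \<mu> U \<le> exp (- real n * (t - s)) * B"
proof -
  interpret prob_space \<mu> using \<mu> by (simp add: borel_probs_def)
  let ?A = "{x\<in>C. measure \<mu> (bowen_ball X T n x e) < weight t (x, n)}"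
  have "?A \<subseteq> M" using C by auto
  then obtain E where E: "finite E" "E \<subseteq> ?A" "disjoint_family_on (\<lambda>x. bowen_cball X T n x (e/3)) E"
    "?A \<subseteq> (\<Union>x\<in>E. bowen_ball X T n x e)"
    by (rule finite_packing_cover[OF _ n e])
  have EM: "x \<in> M" if "x \<in> E" for x using subsetD[OF E(2) that] C by auto
  have "ennreal (\<Sum>p\<in>(\<lambda>x. (x, n)) ` E. weight s p) \<le> ennreal B"
  proof (rule order_trans[OF packing_pre_upper bnd])
    show "disjoint_family_on (node_ball (e/3)) ((\<lambda>x. (x, n)) ` E)"
      using E(3) by (auto simp: disjoint_family_on_def node_ball_def)
  qed (use E n C e in auto)
  then have sB: "(\<Sum>x\<in>E. weight s (x, n)) \<le> B"
    using B by (simp add: sum.reindex inj_on_def)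
  have "measure \<mu> (\<Union>x\<in>E. bowen_ball X T n x e) \<le> (\<Sum>x\<in>E. measure \<mu> (bowen_ball X T n x e))"
    by (rule measure_UNION_le) (use E(1) bowen_ball_measurable[OF \<mu> EM n] in auto)
  also have "\<dots> \<le> (\<Sum>x\<in>E. weight t (x, n))"
    by (rule sum_mono) (use E(2) in auto)
  also have "\<dots> = exp (- real n * (t - s)) * (\<Sum>x\<in>E. weight s (x, n))"
    unfolding sum_distrib_left by (rule sum.cong) (auto simp: weight_def algebra_simps simp flip: exp_add)
  also have "\<dots> \<le> exp (- real n * (t - s)) * B"
    by (rule mult_left_mono[OF sB]) simp
  finally show ?thesis
    using E(1,4) bowen_ball_measurable[OF \<mu> EM n] by (intro bexI[of _ "\<Union>x\<in>E. bowen_ball X T n x e"]) auto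
qed

lemma local_pressure_quotient_le:
  assumes n: "n > 0" and m: "m \<ge> weight t (x, n)"
  shows "(- log_ext m + ereal (birkhoff_sum T f n x)) / ereal (real n) \<le> ereal t"
proof -
  have pos: "0 < m" using m weight_pos[of t "(x, n)"] by simp
  have "ln (weight t (x, n)) \<le> ln m" using m pos weight_pos by simp
  then have "- real n * t + birkhoff_sum T f n x \<le> ln m" by (simp add: weight_def)
  then have "(- ln m + birkhoff_sum T f n x) / real n \<le> t"
    using n by (simp add: field_simps)
  then show ?thesis using pos n by (simp add: log_ext_def)
qed

lemma AE_local_pressure_at_le:
  assumes \<mu>: "\<mu> \<in> borel_probs (X 0)" and C: "C \<subseteq> M" and e: "e > 0"
    and fin: "packing_pre_inf X T f s (e/3) C < \<infinity>" and st: "s < t"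
  shows "AE x in \<mu>. x \<in> C \<longrightarrow> local_pressure_at \<mu> x e \<le> ereal t"
proof -
  interpret prob_space \<mu> using \<mu> by (simp add: borel_probs_def)
  obtain N B where N: "N > 0" "0 \<le> B" and B: "\<And>n. n \<ge> N \<Longrightarrow> packing_pre X T f s n (e/3) C \<le> ennreal B"
    using packing_pre_inf_finiteD[OF fin] by blast
  define A where "A n = {x\<in>C. measure \<mu> (bowen_ball X T n x e) < weight t (x, n)}" for n
  \<comment> \<open>The premeasure bound is available only from \<open>N\<close> on; below
    \<open>N\<close> the empty set serves as a placeholder.\<close>
  have "\<exists>U\<in>sets \<mu>. (n \<ge> N \<longrightarrow> A n \<subseteq> U) \<and> measure \<mu> U \<le> exp (- real n * (t - s)) * B" for n
  proof (cases "n \<ge> N")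
    case True
    then show ?thesis
      using ball_measure_bound[OF \<mu> C e _ N(2) B[OF True], of t] N unfolding A_def by auto
  qed (use N in \<open>auto intro!: bexI[of _ "{}"]\<close>)
  then obtain U where U: "\<And>n. U n \<in> sets \<mu>" "\<And>n. n \<ge> N \<Longrightarrow> A n \<subseteq> U n"
    "\<And>n. measure \<mu> (U n) \<le> exp (- real n * (t - s)) * B"
    by metis
  have "summable (\<lambda>n. exp (- (t - s)) ^ n * B)"
    using st by (intro summable_mult2 summable_geometric) simp
  moreover have "exp (- (t - s)) ^ n = exp (- real n * (t - s))" for n
    by (subst exp_of_nat_mult[symmetric]) (simp add: algebra_simps)
  ultimately have "summable (\<lambda>n. exp (- real n * (t - s)) * B)" by simp
  then have "summable (\<lambda>n. measure \<mu> (U n))"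
    by (rule summable_comparison_test_ev[rotated]) (use U(3) in auto)
  then have "AE x in \<mu>. eventually (\<lambda>n. x \<in> space \<mu> - U n) sequentially"
    by (intro borel_cantelli_AE1 U) (auto simp: emeasure_eq_measure)
  then show ?thesis
  proof eventually_elim
    case (elim x)
    show ?case
    proof
      assume "x \<in> C"
      have "\<forall>\<^sub>F n in sequentially. (- log_ext (measure \<mu> (bowen_ball X T n x e)) + ereal (birkhoff_sum T f n x)) / ereal (real n) \<le> ereal t"
        using elim eventually_ge_at_top[of N]
      proof eventually_elim
        case (elim n)
        then have "x \<notin> A n" using U(2) by auto
        then have "weight t (x, n) \<le> measure \<mu> (bowen_ball X T n x e)"
          using \<open>x \<in> C\<close> by (auto simp: A_def)
        then show ?case using N elim by (intro local_pressure_quotient_le) auto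
      qed
      then show "local_pressure_at \<mu> x e \<le> ereal t"
        unfolding local_pressure_at_def by (rule Limsup_bounded)
    qed
  qed
qed

lemma upper_pressure_le:
  assumes \<mu>: "\<mu> \<in> borel_probs (X 0)" and K: "K \<subseteq> M" "measure \<mu> K = 1"
    and t: "0 \<le> t" "packing_pressure X T f K < ereal t"
  shows "upper_pressure X T f \<mu> \<le> ereal t"
  unfolding upper_pressure_def
proof (rule ereal_integral_le)
  interpret prob_space \<mu> using \<mu> by (simp add: borel_probs_def)
  show "prob_space \<mu>" by unfold_locales
  \<comment> \<open>\<open>measure\<close> is 0 on sets outside the sigma-algebra, so the value 1
    forces measurability.\<close>
  have "K \<in> sets \<mu>" using K(2) measure_notin_sets by force
  then have inK: "AE x in \<mu>. x \<in> K" using K(2) by (simp add: AE_in_set_eq_1)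
  \<comment> \<open>Countably many radii keep the union of the exceptional sets null; every positive
    radius is reached afterwards because the local pressure is antitone in it. The division by 3
    below matches the radii of the covering lemma.\<close>
  have "AE x in \<mu>. x \<in> K \<longrightarrow> local_pressure_at \<mu> x (1 / Suc k) \<le> ereal t" for k
  proof -
    let ?e = "1 / real (Suc k)"
    have "packing_pressure_at X T f K (?e/3) \<le> packing_pressure X T f K"
      unfolding packing_pressure_eq by (rule SUP_upper) simp
    with t have "packing_pressure_at X T f K (?e/3) < ereal t" by simp
    then obtain s where s: "s < t" "packing_measure X T f s (?e/3) K = 0"
      unfolding packing_pressure_at_def Inf_less_iff by auto
    obtain C :: "nat \<Rightarrow> 'a set" where C: "\<And>i. C i \<subseteq> M" "K \<subseteq> (\<Union>i. C i)"
        "\<And>i. packing_pre_inf X T f s (?e/3) (C i) < \<infinity>"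
      using packing_sigma_finite_if_measure_zero[OF s(2)] unfolding packing_sigma_finite_def by blast
    have "AE x in \<mu>. \<forall>i. x \<in> C i \<longrightarrow> local_pressure_at \<mu> x ?e \<le> ereal t"
      unfolding AE_all_countable
      by (intro allI AE_local_pressure_at_le[OF \<mu> C(1) _ C(3) s(1)]) simp
    then show ?thesis by eventually_elim (use C(2) in blast)
  qed
  then have "AE x in \<mu>. \<forall>k. x \<in> K \<longrightarrow> local_pressure_at \<mu> x (1 / Suc k) \<le> ereal t"
    unfolding AE_all_countable by blast
  with inK show "AE x in \<mu>. upper_local_pressure X T f \<mu> x \<le> ereal t"
  proof eventually_elim
    case (elim x)
    have xM: "x \<in> M" using elim K by auto
    show ?case unfolding upper_local_pressure_eq[OF \<mu> xM]
    proof (rule SUP_least)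
      fix e :: real assume "e \<in> {0<..}"
      then obtain k where "1 / Suc k < e" using nat_approx_posE[of e] by auto
      then have "local_pressure_at \<mu> x e \<le> local_pressure_at \<mu> x (1 / Suc k)"
        by (intro local_pressure_at_antimono[OF \<mu> xM]) simp
      also have "\<dots> \<le> ereal t" using elim by simp
      finally show "local_pressure_at \<mu> x e \<le> ereal t" .
    qed
  qed
qed (use t in auto)

section \<open>A measure of large pressure\<close>

lemma packing_sigma_finite_Un:
  assumes "packing_sigma_finite s e A" "packing_sigma_finite s e B"
  shows "packing_sigma_finite s e (A \<union> B)"
  using packing_sigma_finite_UN[of "{A, B}" s e "\<lambda>A. A"] assms by auto

text \<open>An analogue of the support of a measure, with the sets in the ideal
  \<open>packing_sigma_finite\<close> in the role of null sets.\<close>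

definition core :: "real \<Rightarrow> real \<Rightarrow> 'a set \<Rightarrow> 'a set" where
  "core s e K = {x \<in> K. \<forall>r>0. \<not> packing_sigma_finite s e (K \<inter> mball_of (X 0) x r)}"

text \<open>A Lindelof argument: finite nets at the scales \<open>1 / real (Suc n)\<close> give
  countably many balls, and each removed point lies in one of them whose trace on \<open>K\<close>
  is sigma-finite.\<close>

lemma packing_sigma_finite_diff_core:
  assumes K: "K \<subseteq> M"
  shows "packing_sigma_finite s e (K - core s e K)"
proof -
  interpret Metric_space M d by auto
  have "compactin mtopology M"
    using nds unfolding nds_def compact_space_def by (metis mtopology_of_def topspace_mtopology_of)
  then have "mtotally_bounded M" by (rule compactin_imp_mtotally_bounded)
  then have "\<exists>F. finite F \<and> M \<subseteq> (\<Union>x\<in>F. mball x (1 / real (Suc n)))" for n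
    unfolding mtotally_bounded_def by (meson divide_pos_pos of_nat_0_less_iff zero_less_Suc zero_less_one)
  then obtain F where F: "\<And>n. finite (F n)" "\<And>n. M \<subseteq> (\<Union>x\<in>F n. mball x (1 / real (Suc n)))"
    by metis
  define J where "J = {(n, c). c \<in> F n \<and> packing_sigma_finite s e (K \<inter> mball c (1 / real (Suc n)))}"
  have "J \<subseteq> Sigma UNIV F" by (auto simp: J_def)
  then have "countable J"
    by (rule countable_subset) (intro countable_SIGMA countableI_type countable_finite F)
  then have "packing_sigma_finite s e (\<Union>(n, c)\<in>J. K \<inter> mball c (1 / real (Suc n)))"
    by (rule packing_sigma_finite_UN) (auto simp: J_def)
  moreover have "K - core s e K \<subseteq> (\<Union>(n, c)\<in>J. K \<inter> mball c (1 / real (Suc n)))"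
  proof
    fix x assume "x \<in> K - core s e K"
    then obtain r where x: "x \<in> K" "x \<in> M" and r: "r > 0" "packing_sigma_finite s e (K \<inter> mball x r)"
      using K unfolding core_def mball_of_def by auto
    \<comment> \<open>A ball of radius below \<open>r / 2\<close> that contains \<open>x\<close>
      lies inside the ball of radius \<open>r\<close> around \<open>x\<close>.\<close>
    obtain n where n: "1 / real (Suc n) < r / 2" using nat_approx_posE[of "r/2"] r(1) by auto
    obtain c where c: "c \<in> F n" "x \<in> mball c (1 / real (Suc n))" using F(2)[of n] x by auto
    have "mball c (1 / real (Suc n)) \<subseteq> mball x r"
    proof
      fix y assume y: "y \<in> mball c (1 / real (Suc n))"
      then have "d x y \<le> d c x + d c y"
        using c(2) mdist_triangle[of x "X 0" c y] by (auto simp: mdist_commute)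
      then show "y \<in> mball x r" using y c(2) n by auto
    qed
    then have "packing_sigma_finite s e (K \<inter> mball c (1 / real (Suc n)))"
      by (intro packing_sigma_finite_subset[OF r(2)]) auto
    then show "x \<in> (\<Union>(n, c)\<in>J. K \<inter> mball c (1 / real (Suc n)))"
      using c x unfolding J_def by blast
  qed
  ultimately show ?thesis by (rule packing_sigma_finite_subset)
qed

lemma core_nonempty:
  assumes "K \<subseteq> M" "\<not> packing_sigma_finite s e K"
  shows "core s e K \<noteq> {}"
  using packing_sigma_finite_diff_core[OF assms(1), of s e] assms(2) by auto

text \<open>The removed part is itself sigma-finite, so its removal changes nothing near a core
  point. Nodes can therefore be chosen with centres in the core and refined there again and
  again.\<close>

lemma core_ball_not_sigma_finite:
  assumes K: "K \<subseteq> M" and x: "x \<in> core s e K" "r > 0"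
  shows "\<not> packing_sigma_finite s e (core s e K \<inter> mball_of (X 0) x r)"
proof
  assume "packing_sigma_finite s e (core s e K \<inter> mball_of (X 0) x r)"
  from packing_sigma_finite_Un[OF this packing_sigma_finite_diff_core[OF K]]
  have "packing_sigma_finite s e (K \<inter> mball_of (X 0) x r)"
    by (rule packing_sigma_finite_subset) auto
  then show False using x unfolding core_def by auto
qed

section \<open>Separated nodes, their stability and their successive refinement\<close>

definition separated :: "real \<Rightarrow> 'a \<times> nat \<Rightarrow> 'a \<times> nat \<Rightarrow> bool" where
  "separated e p q \<longleftrightarrow> (\<exists>j<snd p. e < mdist (X j) (iter T j (fst p)) (iter T j (fst q)))"

lemma not_separated_self: "fst p \<in> M \<Longrightarrow> 0 \<le> e \<Longrightarrow> \<not> separated e p p"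
  by (auto simp: separated_def mdist_self iter_mem)

lemma separated_mono: "separated e (fst p, m) (fst q, m') \<Longrightarrow> m \<le> snd p \<Longrightarrow> separated e p q"
  unfolding separated_def by (auto intro: less_le_trans)

text \<open>The centre of \<open>q\<close> lies in its own ball, hence outside that of
  \<open>p\<close>. Separation records only this one-sided consequence of disjointness, and its
  strict inequality makes it an open condition on the two centres.\<close>

lemma separated_if_disjoint:
  assumes "fst p \<in> M" "fst q \<in> M" "0 < snd p" "0 < snd q" "0 \<le> e" "node_ball e p \<inter> node_ball e q = {}"
  shows "separated e p q"
proof -
  have "fst q \<notin> node_ball e p" using node_mem_node_ball[of q e] assms by auto
  then show ?thesis
    using assms by (auto simp: node_ball_def mem_bowen_cball separated_def not_le)
qed

text \<open>Near a core point the premeasure is infinite, so at every \<open>N\<close> some finite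
  packing has weight above any bound. The bound 1 is the total mass of the unit interval that is to
  be distributed.\<close>

lemma core_descendants:
  assumes K: "K \<subseteq> M" and x: "x \<in> core s e K" and r: "r > 0" and e: "e > 0" and N: "N > 0"
  shows "\<exists>E. finite E \<and> E \<subseteq> (core s e K \<inter> mball_of (X 0) x r) \<times> {N..} \<and> pairwise (separated e) E \<and>
    1 \<le> (\<Sum>p\<in>E. weight s p)"
proof -
  define Z where "Z = core s e K \<inter> mball_of (X 0) x r"
  have Z: "Z \<subseteq> M" using K by (auto simp: Z_def core_def)
  have "\<not> packing_pre_inf X T f s e Z < \<infinity>"
  proof
    assume "packing_pre_inf X T f s e Z < \<infinity>"
    then have "packing_sigma_finite s e Z"
      unfolding packing_sigma_finite_def using Z by (intro exI[of _ "\<lambda>_. Z"]) auto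
    then show False using core_ball_not_sigma_finite[OF K x r] unfolding Z_def by blast
  qed
  moreover have "packing_pre_inf X T f s e Z \<le> packing_pre X T f s N e Z"
    unfolding packing_pre_inf_eq by (rule INF_lower) simp
  ultimately have "\<not> packing_pre X T f s N e Z \<le> ennreal 1"
    by (metis ennreal_less_top infinity_ennreal_def le_less_trans)
  then obtain E where E: "finite E" "E \<subseteq> Z \<times> {N..}" "disjoint_family_on (node_ball e) E"
    "\<not> ennreal (\<Sum>p\<in>E. weight s p) \<le> ennreal 1"
    unfolding packing_pre_le_iff[OF N Z less_imp_le[OF e]] by blast
  have "1 \<le> (\<Sum>p\<in>E. weight s p)" using E(4) by (metis ennreal_leI linear)
  moreover have "pairwise (separated e) E"
  proof (rule pairwiseI)
    fix p q assume pq: "p \<in> E" "q \<in> E" "p \<noteq> q"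
    have "fst p \<in> M" "fst q \<in> M" "0 < snd p" "0 < snd q"
      using subsetD[OF E(2) pq(1)] subsetD[OF E(2) pq(2)] Z N by (auto simp: mem_Times_iff)
    then show "separated e p q"
      using E(3) pq e by (intro separated_if_disjoint) (auto simp: disjoint_family_on_def)
  qed
  ultimately show ?thesis using E(1,2) unfolding Z_def by blast
qed

lemma continuous_birkhoff_sum: "continuous_map \<tau> euclideanreal (birkhoff_sum T f n)"
proof -
  have "continuous_map \<tau> euclideanreal (f j \<circ> iter T j)" for j
    using continuous by (intro continuous_map_compose[OF continuous_iter]) (simp add: continuous_seq_def)
  then show ?thesis
    unfolding birkhoff_sum_def by (intro continuous_map_sum) (auto simp: comp_def)
qed

text \<open>Both properties of a finite set of nodes survive moving the centres by at most \<open>\<gamma>\<close>.\<close>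
definition robust :: "real \<Rightarrow> real \<Rightarrow> ('a \<times> nat) set \<Rightarrow> bool" where
  "robust e \<gamma> P \<longleftrightarrow>
     (\<forall>p\<in>P. \<forall>q\<in>P. p \<noteq> q \<longrightarrow> (\<forall>z\<in>M. \<forall>u\<in>M.
        d (fst p) z \<le> \<gamma> \<longrightarrow> d (fst q) u \<le> \<gamma> \<longrightarrow> separated e (z, snd p) (u, snd q))) \<and>
     (\<forall>p\<in>P. \<forall>z\<in>M. d (fst p) z \<le> \<gamma> \<longrightarrow>
        birkhoff_sum T f (snd p) (fst p) \<le> birkhoff_sum T f (snd p) z + 1)"

lemma robust_separated:
  assumes "robust e \<gamma> P" "p \<in> P" "q \<in> P" "p \<noteq> q" "z \<in> M" "u \<in> M" "d (fst p) z \<le> \<gamma>" "d (fst q) u \<le> \<gamma>"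
  shows "separated e (z, snd p) (u, snd q)"
  using assms unfolding robust_def by simp

lemma robust_birkhoff_sum:
  assumes "robust e \<gamma> P" "p \<in> P" "z \<in> M" "d (fst p) z \<le> \<gamma>"
  shows "birkhoff_sum T f (snd p) (fst p) \<le> birkhoff_sum T f (snd p) z + 1"
  using assms unfolding robust_def by simp

lemma separated_open:
  assumes "fst p \<in> M" "fst q \<in> M" "separated e p q"
  shows "\<exists>b>0. \<forall>z\<in>M. \<forall>u\<in>M. d (fst p) z < b \<longrightarrow> d (fst q) u < b \<longrightarrow> separated e (z, snd p) (u, snd q)"
proof -
  obtain j where j: "j < snd p" "e < mdist (X j) (iter T j (fst p)) (iter T j (fst q))"
    using assms(3) unfolding separated_def by auto
  \<comment> \<open>Half of the excess over \<open>e\<close>: each of the two centres may move by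
    less than this at time \<open>j\<close>.\<close>
  define \<eta> where "\<eta> = (mdist (X j) (iter T j (fst p)) (iter T j (fst q)) - e) / 2"
  have \<eta>: "\<eta> > 0" using j by (simp add: \<eta>_def)
  obtain b1 where b1: "b1 > 0" "\<forall>z\<in>M. d (fst p) z < b1 \<longrightarrow> (\<forall>i<Suc j. mdist (X i) (iter T i (fst p)) (iter T i z) < \<eta>)"
    using iter_close[OF assms(1) \<eta>] by blast
  obtain b2 where b2: "b2 > 0" "\<forall>z\<in>M. d (fst q) z < b2 \<longrightarrow> (\<forall>i<Suc j. mdist (X i) (iter T i (fst q)) (iter T i z) < \<eta>)"
    using iter_close[OF assms(2) \<eta>] by blast
  have "separated e (z, snd p) (u, snd q)"
    if zu: "z \<in> M" "u \<in> M" "d (fst p) z < min b1 b2" "d (fst q) u < min b1 b2" for z u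
  proof -
    let ?p = "iter T j (fst p)" and ?q = "iter T j (fst q)" and ?z = "iter T j z" and ?u = "iter T j u"
    have mem: "?p \<in> mspace (X j)" "?q \<in> mspace (X j)" "?z \<in> mspace (X j)" "?u \<in> mspace (X j)"
      using assms zu by (auto intro: iter_mem)
    have "mdist (X j) ?p ?z < \<eta>" "mdist (X j) ?q ?u < \<eta>"
      using b1 b2 zu by auto
    moreover have "mdist (X j) ?p ?q \<le> mdist (X j) ?p ?z + mdist (X j) ?z ?q"
      by (rule mdist_triangle[OF mem(1,3,2)])
    moreover have "mdist (X j) ?z ?q \<le> mdist (X j) ?z ?u + mdist (X j) ?q ?u"
      using mdist_triangle[OF mem(3,4,2)] by (simp add: mdist_commute)
    ultimately have "e < mdist (X j) ?z ?u" unfolding \<eta>_def by (simp add: field_simps)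
    then show ?thesis using j(1) unfolding separated_def by auto
  qed
  then show ?thesis using b1(1) b2(1) by (intro exI[of _ "min b1 b2"]) auto
qed

lemma birkhoff_sum_open:
  assumes "x \<in> M"
  shows "\<exists>b>0. \<forall>z\<in>M. d x z < b \<longrightarrow> birkhoff_sum T f n x \<le> birkhoff_sum T f n z + 1"
proof -
  have "continuous_map \<tau> (mtopology_of euclidean_metric) (birkhoff_sum T f n)"
    using continuous_birkhoff_sum by simp
  then obtain b where "b > 0" "\<forall>z. z \<in> M \<and> d x z < b \<longrightarrow> dist (birkhoff_sum T f n x) (birkhoff_sum T f n z) < 1"
    using assms unfolding metric_continuous_map_of by (metis mdist_euclidean_metric zero_less_one)
  then show ?thesis by (intro exI[of _ b]) (force simp: dist_real_def)
qed

text \<open>Finitely many open conditions hold simultaneously for all small positive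
  \<open>\<gamma>\<close>, expressed by intersecting events of the filter
  \<open>at_right 0\<close>.\<close>

lemma robust_exists:
  assumes P: "finite P" "fst ` P \<subseteq> M" "pairwise (separated e) P" and c: "c > 0"
  shows "\<exists>\<gamma>>0. \<gamma> \<le> c \<and> robust e \<gamma> P"
proof -
  have PM: "fst p \<in> M" if "p \<in> P" for p using that P(2) by auto
  have "\<forall>p\<in>P. \<forall>\<^sub>F \<gamma> in at_right 0. \<forall>z\<in>M. d (fst p) z \<le> \<gamma> \<longrightarrow>
        birkhoff_sum T f (snd p) (fst p) \<le> birkhoff_sum T f (snd p) z + 1"
  proof
    fix p assume "p \<in> P"
    then obtain b where "b > 0" "\<forall>z\<in>M. d (fst p) z < b \<longrightarrow> birkhoff_sum T f (snd p) (fst p) \<le> birkhoff_sum T f (snd p) z + 1"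
      using birkhoff_sum_open PM by blast
    then show "\<forall>\<^sub>F \<gamma> in at_right 0. \<forall>z\<in>M. d (fst p) z \<le> \<gamma> \<longrightarrow>
        birkhoff_sum T f (snd p) (fst p) \<le> birkhoff_sum T f (snd p) z + 1"
      unfolding eventually_at_right_field by (meson le_less_trans)
  qed
  then have 1: "\<forall>\<^sub>F \<gamma> in at_right 0. \<forall>p\<in>P. \<forall>z\<in>M. d (fst p) z \<le> \<gamma> \<longrightarrow>
        birkhoff_sum T f (snd p) (fst p) \<le> birkhoff_sum T f (snd p) z + 1"
    by (rule eventually_ball_finite[OF P(1)])
  have "\<forall>p\<in>P. \<forall>\<^sub>F \<gamma> in at_right 0. \<forall>q\<in>P. p \<noteq> q \<longrightarrow> (\<forall>z\<in>M. \<forall>u\<in>M.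
        d (fst p) z \<le> \<gamma> \<longrightarrow> d (fst q) u \<le> \<gamma> \<longrightarrow> separated e (z, snd p) (u, snd q))"
  proof (intro ballI eventually_ball_finite[OF P(1)])
    fix p q assume pq: "p \<in> P" "q \<in> P"
    show "\<forall>\<^sub>F \<gamma> in at_right 0. p \<noteq> q \<longrightarrow> (\<forall>z\<in>M. \<forall>u\<in>M.
        d (fst p) z \<le> \<gamma> \<longrightarrow> d (fst q) u \<le> \<gamma> \<longrightarrow> separated e (z, snd p) (u, snd q))"
    proof (cases "p = q")
      case False
      then obtain b where "b > 0" "\<forall>z\<in>M. \<forall>u\<in>M. d (fst p) z < b \<longrightarrow> d (fst q) u < b \<longrightarrow> separated e (z, snd p) (u, snd q)"
        using separated_open[OF PM PM, of p q e] pq P(3) by (auto simp: pairwise_def)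
      then show ?thesis
        unfolding eventually_at_right_field by (meson le_less_trans)
    qed simp
  qed
  then have 2: "\<forall>\<^sub>F \<gamma> in at_right 0. \<forall>p\<in>P. \<forall>q\<in>P. p \<noteq> q \<longrightarrow> (\<forall>z\<in>M. \<forall>u\<in>M.
        d (fst p) z \<le> \<gamma> \<longrightarrow> d (fst q) u \<le> \<gamma> \<longrightarrow> separated e (z, snd p) (u, snd q))"
    by (rule eventually_ball_finite[OF P(1)])
  have 3: "\<forall>\<^sub>F \<gamma>::real in at_right 0. 0 < \<gamma> \<and> \<gamma> \<le> c"
    unfolding eventually_at_right_field using c by (auto intro: exI[of _ c])
  from eventually_happens'[OF _ eventually_conj[OF 3 eventually_conj[OF 2 1]]]
  show ?thesis unfolding robust_def by auto
qed

text \<open>The function \<open>g\<close> labels the points of the unit interval by nodes, and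
  \<open>\<gamma>\<close> is the total drift of the centres tolerated at all later stages. The last
  clause says that the image of Lebesgue measure under \<open>g\<close> gives each node at most its
  weight.\<close>

definition stage :: "real \<Rightarrow> real \<Rightarrow> 'a set \<Rightarrow> nat \<Rightarrow> (real \<Rightarrow> 'a \<times> nat) \<times> real \<Rightarrow> bool" where
  "stage s e K n S \<longleftrightarrow> (case S of (g, \<gamma>) \<Rightarrow>
     g \<in> measurable unit_lebesgue (count_space UNIV) \<and> finite (range g) \<and>
     range g \<subseteq> core s e K \<times> {Suc n..} \<and> 0 < \<gamma> \<and> \<gamma> \<le> 1 / real (Suc n) \<and> robust e \<gamma> (range g) \<and>
     (\<forall>p. measure unit_lebesgue {t \<in> space unit_lebesgue. g t = p} \<le> weight s p))"

text \<open>Each value of \<open>g\<close> receives its own descendants from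
  \<open>core_descendants\<close>, and the piece of the interval where \<open>g\<close> takes that
  value is distributed over them. Hypothesis \<open>cross\<close>, in place of
  \<open>robust\<close>, lets a constant \<open>g\<close> of order 0 start the construction.\<close>

lemma stage_refine:
  assumes K: "K \<subseteq> M" and e: "e > 0" and r: "r > 0" and c: "c > 0"
    and g [measurable]: "g \<in> measurable unit_lebesgue (count_space UNIV)"
    and fin: "finite (range g)" and sub: "fst ` range g \<subseteq> core s e K"
    and cross: "\<And>p q z u. p \<in> range g \<Longrightarrow> q \<in> range g \<Longrightarrow> p \<noteq> q \<Longrightarrow> z \<in> M \<Longrightarrow> u \<in> M \<Longrightarrow>
        d (fst p) z \<le> r \<Longrightarrow> d (fst q) u \<le> r \<Longrightarrow> separated e (z, snd p) (u, snd q)"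
  shows "\<exists>g' \<gamma>'. stage s e K n (g', \<gamma>') \<and> \<gamma>' \<le> c \<and> (\<forall>t. d (fst (g t)) (fst (g' t)) \<le> r)"
proof -
  \<comment> \<open>At least every order occurring in \<open>g\<close>, so separation of parents
    passes to descendants by \<open>separated_mono\<close>; the summand \<open>Suc n\<close> makes
    the orders tend to infinity.\<close>
  define N where "N = Suc n + Max (snd ` range g)"
  have N: "snd (g t) \<le> N" for t
    using fin unfolding N_def by (intro trans_le_add2 Max_ge) auto
  have "\<forall>p\<in>range g. \<exists>E. finite E \<and> E \<subseteq> (core s e K \<inter> mball_of (X 0) (fst p) r) \<times> {N..} \<and>
      pairwise (separated e) E \<and> 1 \<le> (\<Sum>q\<in>E. weight s q)"
    using sub by (intro ballI core_descendants[OF K _ r e]) (auto simp: N_def)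
  then obtain E where E: "\<And>t. finite (E (g t))"
    "\<And>t. E (g t) \<subseteq> (core s e K \<inter> mball_of (X 0) (fst (g t)) r) \<times> {N..}"
    "\<And>t. pairwise (separated e) (E (g t))" "\<And>t. 1 \<le> (\<Sum>q\<in>E (g t). weight s q)"
    by (metis rangeI)
  have E': "fst q \<in> core s e K" "fst q \<in> M" "d (fst (g t)) (fst q) \<le> r" "N \<le> snd q" if "q \<in> E (g t)" for q t
    using subsetD[OF E(2) that] by (auto simp: mem_Times_iff)
  have "\<forall>p\<in>range g. \<exists>\<phi>. \<phi> \<in> measurable unit_lebesgue (count_space UNIV) \<and> (\<forall>t. \<phi> t \<in> E p) \<and>
      (\<forall>q\<in>E p. measure unit_lebesgue {t \<in> {t \<in> space unit_lebesgue. g t = p}. \<phi> t = q} \<le> weight s q)"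
  proof
    fix p assume p: "p \<in> range g"
    then obtain t where t: "p = g t" by auto
    have "measure unit_lebesgue {t \<in> space unit_lebesgue. g t = p} \<le> 1" by (rule unit.prob_le_1)
    also have "1 \<le> (\<Sum>q\<in>E p. weight s q)" using E(4)[of t] t by simp
    finally show "\<exists>\<phi>. \<phi> \<in> measurable unit_lebesgue (count_space UNIV) \<and> (\<forall>t. \<phi> t \<in> E p) \<and>
      (\<forall>q\<in>E p. measure unit_lebesgue {t \<in> {t \<in> space unit_lebesgue. g t = p}. \<phi> t = q} \<le> weight s q)"
    proof (intro unit_lebesgue_distribute)
      show "{u \<in> space unit_lebesgue. g u = p} \<in> sets unit_lebesgue" by measurable
    qed (use E(1)[of t] E(4)[of t] t in auto)
  qed
  from bchoice[OF this] obtain \<phi> where \<phi>: "\<And>p. p \<in> range g \<Longrightarrow> \<phi> p \<in> measurable unit_lebesgue (count_space UNIV)"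
    "\<And>p t. p \<in> range g \<Longrightarrow> \<phi> p t \<in> E p"
    "\<And>p q. p \<in> range g \<Longrightarrow> q \<in> E p \<Longrightarrow>
       measure unit_lebesgue {t \<in> {t \<in> space unit_lebesgue. g t = p}. \<phi> p t = q} \<le> weight s q"
    by blast
  define g' where "g' t = \<phi> (g t) t" for t
  have g'E: "g' t \<in> E (g t)" for t by (simp add: g'_def \<phi>(2))
  have sep: "separated e q q'" if "q \<in> E (g t)" "q' \<in> E (g t')" "g t \<noteq> g t'" for q q' t t'
  proof (rule separated_mono)
    show "separated e (fst q, snd (g t)) (fst q', snd (g t'))"
      using E'[OF that(1)] E'[OF that(2)] that(3) by (intro cross) auto
    show "snd (g t) \<le> snd q" using N[of t] E'(4)[OF that(1)] by simp
  qed
  have meas: "g' \<in> measurable unit_lebesgue (count_space UNIV)"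
    unfolding g'_def
  proof (rule measurable_compose_countable'[where I = "range g" and f = \<phi> and g = g])
    show "g \<in> measurable unit_lebesgue (count_space (range g))"
      by (rule measurable_count_space_extend[OF _ _ g]) auto
  qed (use \<phi>(1) fin in \<open>auto intro: countable_finite\<close>)
  have "range g' \<subseteq> (\<Union>p\<in>range g. E p)" using g'E by auto
  then have fin': "finite (range g')"
    by (rule finite_subset) (rule finite_UN_I[OF fin], use E(1) in blast)
  have sub': "range g' \<subseteq> core s e K \<times> {Suc n..}"
  proof
    fix q assume "q \<in> range g'"
    then obtain t where "q \<in> E (g t)" using g'E by auto
    from E'(1,4)[OF this] show "q \<in> core s e K \<times> {Suc n..}"
      by (auto simp: mem_Times_iff N_def)
  qed
  have sep': "pairwise (separated e) (range g')"
  proof (rule pairwiseI)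
    fix q q' assume "q \<in> range g'" "q' \<in> range g'" and ne: "q \<noteq> q'"
    then obtain t t' where t: "q = g' t" "q' = g' t'" by auto
    show "separated e q q'"
    proof (cases "g t = g t'")
      case True
      then show ?thesis using E(3)[of t] g'E[of t] g'E[of t'] ne t by (auto simp: pairwise_def)
    next
      case False
      then show ?thesis using sep[OF g'E g'E] t by auto
    qed
  qed
  have w: "measure unit_lebesgue {t \<in> space unit_lebesgue. g' t = q} \<le> weight s q" for q
  proof (cases "q \<in> range g'")
    case True
    then obtain t0 where t0: "q = g' t0" by auto
    have q: "q \<in> E (g t0)" using g'E t0 by simp
    \<comment> \<open>A node descending from two different parents would be separated from itself.
      Hence the level set of \<open>g'\<close> at \<open>q\<close> lies in a single piece of
      \<open>g\<close>, where the weight bound is known.\<close>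
    have "g t = g t0" if "g' t = q" for t
    proof (rule ccontr)
      assume "g t \<noteq> g t0"
      from sep[OF _ q this, of q] g'E[of t] that have "separated e q q" by auto
      then show False using not_separated_self[OF E'(2)[OF q], of e] e by auto
    qed
    then have eq: "{t \<in> space unit_lebesgue. g' t = q} =
        {t \<in> {t \<in> space unit_lebesgue. g t = g t0}. \<phi> (g t0) t = q}"
      unfolding g'_def by auto
    show ?thesis unfolding eq by (rule \<phi>(3)) (use q in auto)
  next
    case False
    then have "{t \<in> space unit_lebesgue. g' t = q} = {}" by auto
    then show ?thesis by (simp only: measure_empty weight_nonneg)
  qed
  have "fst ` range g' \<subseteq> M" using E'(2)[OF g'E] by auto
  then obtain \<gamma>' where "\<gamma>' > 0" "\<gamma>' \<le> min c (1 / real (Suc n))" "robust e \<gamma>' (range g')"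
    using robust_exists[OF fin' _ sep', of "min c (1 / real (Suc n))"] c by auto
  moreover have "d (fst (g t)) (fst (g' t)) \<le> r" for t using E'(3)[OF g'E] .
  ultimately show ?thesis
    using meas fin' sub' w unfolding stage_def by (intro exI[of _ g'] exI[of _ \<gamma>']) auto
qed

text \<open>Dependent choice. A centre moves by at most half the current tolerance, and the next
  tolerance is at most the other half, so all later drift stays within
  \<open>\<Gamma> n\<close>.\<close>

lemma stage_sequence:
  assumes K: "K \<subseteq> M" and e: "e > 0" and not: "\<not> packing_sigma_finite s e K"
  obtains G \<Gamma> where "\<And>n. stage s e K n (G n, \<Gamma> n)" "\<And>n. \<Gamma> (Suc n) \<le> \<Gamma> n / 2"
    "\<And>n t. d (fst (G n t)) (fst (G (Suc n) t)) \<le> \<Gamma> n / 2"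
proof -
  define Q where "Q = (\<lambda>(n::nat) (S :: (real \<Rightarrow> 'a \<times> nat) \<times> real) (S' :: (real \<Rightarrow> 'a \<times> nat) \<times> real).
     snd S' \<le> snd S / 2 \<and> (\<forall>t. d (fst (fst S t)) (fst (fst S' t)) \<le> snd S / 2))"
  obtain x0 where x0: "x0 \<in> core s e K" using core_nonempty[OF K not] by auto
  \<comment> \<open>With a one-point range the hypothesis \<open>cross\<close> is vacuous.\<close>
  have start: "\<exists>S. stage s e K 0 S"
    using stage_refine[of K e 1 1 "\<lambda>_. (x0, 0)" s 0] K e x0 by auto
  have step: "\<exists>S'. stage s e K (Suc n) S' \<and> Q n S S'" if st: "stage s e K n S" for S n
  proof -
    obtain g \<gamma> where S: "S = (g, \<gamma>)" by (cases S)
    have g: "g \<in> measurable unit_lebesgue (count_space UNIV)" "finite (range g)"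
      "range g \<subseteq> core s e K \<times> {Suc n..}" "0 < \<gamma>" "robust e \<gamma> (range g)"
      using st by (auto simp: S stage_def)
    have "\<exists>g' \<gamma>'. stage s e K (Suc n) (g', \<gamma>') \<and> \<gamma>' \<le> \<gamma>/2 \<and> (\<forall>t. d (fst (g t)) (fst (g' t)) \<le> \<gamma>/2)"
    proof (rule stage_refine[OF K e])
      fix p q z u assume "p \<in> range g" "q \<in> range g" "p \<noteq> q" "z \<in> M" "u \<in> M"
        "d (fst p) z \<le> \<gamma>/2" "d (fst q) u \<le> \<gamma>/2"
      moreover from this have "d (fst p) z \<le> \<gamma>" "d (fst q) u \<le> \<gamma>" using g(4) by auto
      ultimately show "separated e (z, snd p) (u, snd q)" using g(5) unfolding robust_def by blast
    qed (use g in auto)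
    then show ?thesis by (auto simp: Q_def S)
  qed
  obtain S where S: "\<And>n. stage s e K n (S n)" "\<And>n. Q n (S n) (S (Suc n))"
    using dependent_nat_choice[of "stage s e K" Q, OF start step] by blast
  show ?thesis
    by (rule that[of "\<lambda>n. fst (S n)" "\<lambda>n. snd (S n)"]) (use S in \<open>auto simp: Q_def\<close>)
qed

section \<open>The limit map and its image measure\<close>

lemma closedin_compact: "compactin \<tau> K \<Longrightarrow> closedin \<tau> K"
proof -
  interpret Metric_space M d by auto
  show "compactin \<tau> K \<Longrightarrow> closedin \<tau> K"
    unfolding mtopology_of_def by (rule compactin_imp_closedin[OF Hausdorff_space_mtopology])
qed

lemma closedin_mcball: "closedin \<tau> (mcball_of (X 0) x r)"
proof -
  interpret Metric_space M d by auto
  show ?thesis unfolding mtopology_of_def mcball_of_def by (rule closedin_mcball)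
qed

text \<open>The two halves add up to \<open>\<Gamma> n\<close>, so the balls, cut down to
  \<open>K\<close>, form a decreasing sequence of nonempty closed sets in a compact space.\<close>

lemma nested_mcballs_meet:
  assumes K: "compactin \<tau> K"
    and y: "\<And>n. y n \<in> K" and pos: "\<And>n. 0 \<le> \<Gamma> n"
    and step: "\<And>n. \<Gamma> (Suc n) \<le> \<Gamma> n / 2" "\<And>n. d (y n) (y (Suc n)) \<le> \<Gamma> n / 2"
  shows "\<exists>x\<in>K. \<forall>n. d (y n) x \<le> \<Gamma> n"
proof -
  have KM: "K \<subseteq> M" using compactin_subset_topspace[OF K] by simp
  define C where "C n = K \<inter> mcball_of (X 0) (y n) (\<Gamma> n)" for n
  have yM: "y n \<in> M" for n using y KM by auto
  have "C (Suc n) \<subseteq> C n" for n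
  proof
    fix x assume "x \<in> C (Suc n)"
    then have x: "x \<in> K" "x \<in> M" "d (y (Suc n)) x \<le> \<Gamma> (Suc n)" by (auto simp: C_def)
    have "d (y n) x \<le> d (y n) (y (Suc n)) + d (y (Suc n)) x"
      by (rule mdist_triangle) (use yM x in auto)
    then have "d (y n) x \<le> \<Gamma> n" using step[of n] x by linarith
    then show "x \<in> C n" using x yM by (simp add: C_def)
  qed
  then have "decseq C" by (rule decseq_SucI)
  moreover have "y n \<in> C n" for n
    using y yM pos by (simp add: C_def mdist_self)
  then have "C n \<noteq> {}" for n by blast
  moreover have "closedin \<tau> (C n)" for n
    unfolding C_def by (intro closedin_Int closedin_compact K closedin_mcball)
  moreover have "compact_space \<tau>" using nds by (simp add: nds_def)
  ultimately have "(\<Inter>n. C n) \<noteq> {}" by (intro compact_space_imp_nest) auto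
  then obtain x where "\<And>n. x \<in> C n" by blast
  then show ?thesis by (intro bexI[of _ x]) (simp_all add: C_def)
qed

text \<open>The point \<open>h t\<close> lies in a closed set exactly when each \<open>G n t\<close>
  is within \<open>\<Gamma> n\<close> of some point of it. As \<open>G n\<close> is measurable into
  \<open>count_space UNIV\<close>, each of these countably many conditions is measurable.\<close>

lemma measurable_limit:
  assumes G: "\<And>n. G n \<in> measurable N (count_space UNIV)" and GM: "\<And>n t. G n t \<in> M"
    and h: "\<And>t. t \<in> space N \<Longrightarrow> h t \<in> M" "\<And>n t. t \<in> space N \<Longrightarrow> d (G n t) (h t) \<le> \<Gamma> n"
    and \<Gamma>: "\<Gamma> \<longlonglongrightarrow> 0"
  shows "h \<in> measurable N (borel_of \<tau>)"
proof (rule measurable_sigma_sets[OF sets_borel_of_closed])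
  show "{A. closedin \<tau> A} \<subseteq> Pow (topspace \<tau>)" using closedin_subset by blast
  show "h \<in> space N \<rightarrow> topspace \<tau>" using h by auto
  fix C assume "C \<in> {A. closedin \<tau> A}"
  then have C: "closedin \<tau> C" by simp
  have CM: "C \<subseteq> M" using closedin_subset[OF C] by simp
  have "h -` C \<inter> space N = {t \<in> space N. \<forall>n. G n t \<in> {y. \<exists>c\<in>C. d y c \<le> \<Gamma> n}}"
  proof (intro equalityI subsetI)
    fix t assume t: "t \<in> {t \<in> space N. \<forall>n. G n t \<in> {y. \<exists>c\<in>C. d y c \<le> \<Gamma> n}}"
    have hM: "h t \<in> M" using h t by auto
    have "h t \<in> C"
    proof (rule ccontr)
      assume "h t \<notin> C"
      moreover have "openin \<tau> (M - C)" using C by (simp add: closedin_def)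
      ultimately obtain r where r: "r > 0" "\<forall>y\<in>M. d (h t) y < r \<longrightarrow> y \<in> M - C"
        unfolding openin_\<tau> using hM by blast
      have "\<forall>\<^sub>F n in sequentially. \<Gamma> n < r/2" using \<Gamma> r(1) by (intro order_tendstoD) auto
      then obtain n where n: "\<Gamma> n < r/2" by (auto simp: eventually_sequentially)
      obtain c where c: "c \<in> C" "d (G n t) c \<le> \<Gamma> n" using t by auto
      have "d (h t) c \<le> d (h t) (G n t) + d (G n t) c"
        by (rule mdist_triangle) (use hM GM c CM in auto)
      also have "d (h t) (G n t) \<le> \<Gamma> n" using h(2)[of t n] t by (simp add: mdist_commute)
      finally have "d (h t) c < r" using c n by linarith
      then show False using r(2) c CM by auto
    qed
    then show "t \<in> h -` C \<inter> space N" using t by auto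
  qed (use h in auto)
  moreover have "{t \<in> space N. \<forall>n. G n t \<in> {y. \<exists>c\<in>C. d y c \<le> \<Gamma> n}} \<in> sets N"
  proof (rule sets.sets_Collect_countable_All)
    fix n
    have "G n -` {y. \<exists>c\<in>C. d y c \<le> \<Gamma> n} \<inter> space N \<in> sets N"
      by (rule measurable_sets[OF G]) simp
    then show "{t \<in> space N. G n t \<in> {y. \<exists>c\<in>C. d y c \<le> \<Gamma> n}} \<in> sets N"
      by (simp only: vimage_def Int_def mem_Collect_eq conj_commute)
  qed
  ultimately show "h -` C \<inter> space N \<in> sets N" by simp
qed

text \<open>The additive 1 tolerated in the Birkhoff sum costs only \<open>1 / real (snd p)\<close>,
  which vanishes as the orders grow. For \<open>m = 0\<close> the quotient is infinite.\<close>

lemma local_pressure_quotient_ge: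
  assumes "m \<le> weight s p" "snd p > 0" "0 \<le> m"
    and "birkhoff_sum T f (snd p) (fst p) \<le> birkhoff_sum T f (snd p) x + 1"
  shows "ereal (s - 1 / real (snd p)) \<le> (- log_ext m + ereal (birkhoff_sum T f (snd p) x)) / ereal (real (snd p))"
proof (cases "m = 0")
  case False
  then have pos: "m > 0" using assms by simp
  have "ln m \<le> ln (weight s p)" using assms(1) pos weight_pos[of s p] by simp
  then have "ln m \<le> - real (snd p) * s + birkhoff_sum T f (snd p) (fst p)" by (simp add: weight_def)
  then have "(s - 1 / real (snd p)) * real (snd p) \<le> - ln m + birkhoff_sum T f (snd p) x"
    using assms by (simp add: algebra_simps)
  then have "s - 1 / real (snd p) \<le> (- ln m + birkhoff_sum T f (snd p) x) / real (snd p)"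
    using assms(2) by (simp add: pos_le_divide_eq)
  then show ?thesis using False assms(2) by (simp add: log_ext_def)
qed (use assms in \<open>simp add: log_ext_def\<close>)

lemma local_pressure_at_ge:
  assumes "\<And>n. \<exists>p. snd p \<ge> Suc n \<and> measure \<mu> (bowen_ball X T (snd p) x e) \<le> weight s p \<and>
      birkhoff_sum T f (snd p) (fst p) \<le> birkhoff_sum T f (snd p) x + 1"
  shows "ereal s \<le> local_pressure_at \<mu> x e"
  unfolding local_pressure_at_def limsup_INF_SUP
proof (rule INF_greatest, rule ereal_le_epsilon2)
  fix n and r :: real assume r: "0 < r"
  let ?v = "\<lambda>m. (- log_ext (measure \<mu> (bowen_ball X T m x e)) + ereal (birkhoff_sum T f m x)) / ereal (real m)"
  obtain k where k: "1 / real (Suc k) < r" using nat_approx_posE[OF r] by auto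
  \<comment> \<open>The order must exceed \<open>k\<close> to make the error less than
    \<open>r\<close>, and \<open>n\<close> to lie in the tail of the limsup.\<close>
  obtain p where p: "snd p \<ge> Suc (max k n)" "measure \<mu> (bowen_ball X T (snd p) x e) \<le> weight s p"
      "birkhoff_sum T f (snd p) (fst p) \<le> birkhoff_sum T f (snd p) x + 1"
    using assms by blast
  have "1 / real (snd p) \<le> 1 / real (Suc k)" using p(1) by (intro divide_left_mono) auto
  then have "ereal s \<le> ereal (s - 1 / real (snd p)) + ereal r" using k by simp
  also have "ereal (s - 1 / real (snd p)) \<le> ?v (snd p)"
    using p by (intro local_pressure_quotient_ge) auto
  also have "?v (snd p) \<le> (SUP m\<in>{n..}. ?v m)"
    by (rule SUP_upper) (use p(1) in auto)
  finally show "ereal s \<le> (SUP m\<in>{n..}. ?v m) + ereal r"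
    by (simp add: add_right_mono)
qed

lemma exists_measure_large_pressure:
  assumes K: "compactin \<tau> K" and e: "e > 0" and s: "s \<ge> 0"
    and not: "\<not> packing_sigma_finite s e K"
  shows "\<exists>\<mu>\<in>borel_probs (X 0). measure \<mu> K = 1 \<and> ereal s \<le> upper_pressure X T f \<mu>"
proof -
  have KM: "K \<subseteq> M" using compactin_subset_topspace[OF K] by simp
  obtain G \<Gamma> where st: "\<And>n. stage s e K n (G n, \<Gamma> n)" and \<Gamma>half: "\<And>n. \<Gamma> (Suc n) \<le> \<Gamma> n / 2"
    and Gclose: "\<And>n t. d (fst (G n t)) (fst (G (Suc n) t)) \<le> \<Gamma> n / 2"
    using stage_sequence[OF KM e not] by blast
  have Gm: "G n \<in> measurable unit_lebesgue (count_space UNIV)" and Gfin: "finite (range (G n))"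
    and Gsub: "range (G n) \<subseteq> core s e K \<times> {Suc n..}"
    and \<Gamma>pos: "0 < \<Gamma> n" and \<Gamma>le: "\<Gamma> n \<le> 1 / real (Suc n)" and rob: "robust e (\<Gamma> n) (range (G n))"
    and wt: "measure unit_lebesgue {t \<in> space unit_lebesgue. G n t = p} \<le> weight s p" for n p
    using st[of n] unfolding stage_def prod.case by blast+
  have GK: "fst p \<in> K" "fst p \<in> M" "Suc n \<le> snd p" if "p \<in> range (G n)" for n p
    using subsetD[OF Gsub that] KM by (auto simp: core_def mem_Times_iff)
  have "\<Gamma> \<longlonglongrightarrow> 0"
  proof (rule tendsto_sandwich[OF _ _ tendsto_const])
    show "(\<lambda>n. 1 / real (Suc n)) \<longlonglongrightarrow> 0" by (rule LIMSEQ_Suc[OF lim_1_over_n])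
  qed (use \<Gamma>pos \<Gamma>le in \<open>auto intro!: always_eventually less_imp_le\<close>)
  have "\<exists>x\<in>K. \<forall>n. d (fst (G n t)) x \<le> \<Gamma> n" for t
    by (intro nested_mcballs_meet K \<Gamma>half Gclose less_imp_le[OF \<Gamma>pos] GK(1)[OF rangeI])
  then obtain h where h: "\<And>t. h t \<in> K" "\<And>n t. d (fst (G n t)) (h t) \<le> \<Gamma> n" by metis
  have hM: "h t \<in> M" for t using h(1) KM by auto
  have h_meas: "h \<in> measurable unit_lebesgue (borel_of \<tau>)"
  proof (rule measurable_limit[where G = "\<lambda>n t. fst (G n t)"])
    show "(\<lambda>t. fst (G n t)) \<in> measurable unit_lebesgue (count_space UNIV)" for n
      by (rule measurable_compose[OF Gm]) simp
  qed (use h(2) hM GK(2)[OF rangeI] \<open>\<Gamma> \<longlonglongrightarrow> 0\<close> in auto)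
  define \<mu> where "\<mu> = distr unit_lebesgue (borel_of \<tau>) h"
  interpret \<mu>: prob_space \<mu> unfolding \<mu>_def by (rule unit.prob_space_distr[OF h_meas])
  have \<mu>: "\<mu> \<in> borel_probs (X 0)"
    unfolding borel_probs_def using \<mu>.prob_space_axioms by (simp add: \<mu>_def)
  have measure_\<mu>: "measure \<mu> A = measure unit_lebesgue {t \<in> space unit_lebesgue. h t \<in> A}"
    if "A \<in> sets (borel_of \<tau>)" for A
    unfolding \<mu>_def measure_distr[OF h_meas that] by (rule arg_cong[of _ _ "measure unit_lebesgue"]) auto
  have full: "measure \<mu> A = 1" if "A \<in> sets (borel_of \<tau>)" "range h \<subseteq> A" for A
  proof -
    have "{t \<in> space unit_lebesgue. h t \<in> A} = space unit_lebesgue" using that(2) by auto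
    then show ?thesis using measure_\<mu>[OF that(1)] unit.prob_space by simp
  qed
  have K1: "measure \<mu> K = 1"
    using h(1) by (intro full closedin_sets_borel_of closedin_compact K) auto
  \<comment> \<open>A closed set of full measure in place of \<open>range h\<close>, whose
    measurability is not established. Each of its points is within \<open>\<Gamma> n\<close> of a
    centre at every stage, which is all that the local estimate uses.\<close>
  define S where "S = (\<Inter>n. \<Union>p\<in>range (G n). mcball_of (X 0) (fst p) (\<Gamma> n))"
  have "closedin \<tau> S"
    unfolding S_def by (intro closedin_INT closedin_Union finite_imageI Gfin) (auto intro: closedin_mcball)
  then have S_sets: "S \<in> sets (borel_of \<tau>)" by (rule closedin_sets_borel_of)
  have "range h \<subseteq> S"
  proof -
    have "h t \<in> mcball_of (X 0) (fst (G n t)) (\<Gamma> n)" for n t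
      using h(2) hM GK(2)[OF rangeI] by simp
    then show ?thesis unfolding S_def by blast
  qed
  then have S1: "measure \<mu> S = 1" by (rule full[OF S_sets])
  have "ereal s \<le> upper_local_pressure X T f \<mu> x" if x: "x \<in> S" for x
  proof -
    have xM: "x \<in> M" using closedin_subset[OF \<open>closedin \<tau> S\<close>] x by auto
    have "\<exists>p. snd p \<ge> Suc n \<and> measure \<mu> (bowen_ball X T (snd p) x e) \<le> weight s p \<and>
      birkhoff_sum T f (snd p) (fst p) \<le> birkhoff_sum T f (snd p) x + 1" for n
    proof -
      have "x \<in> (\<Union>p\<in>range (G n). mcball_of (X 0) (fst p) (\<Gamma> n))"
        using x unfolding S_def by (rule INT_D) (rule UNIV_I)
      then obtain p where p: "p \<in> range (G n)" "x \<in> mcball_of (X 0) (fst p) (\<Gamma> n)"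
        by (rule UN_E)
      then have px: "d (fst p) x \<le> \<Gamma> n" by simp
      have n: "snd p > 0" using GK(3)[OF p(1)] by simp
      \<comment> \<open>If \<open>G n t\<close> differs from \<open>p\<close>, robustness separates
        \<open>x\<close>, close to the centre of \<open>p\<close>, from \<open>h t\<close>, close to
        the centre of \<open>G n t\<close>, by more than \<open>e\<close> at some time below
        \<open>snd p\<close>.\<close>
      have "{t \<in> space unit_lebesgue. h t \<in> bowen_ball X T (snd p) x e} \<subseteq> {t \<in> space unit_lebesgue. G n t = p}"
      proof safe
        fix t assume t: "h t \<in> bowen_ball X T (snd p) x e"
        show "G n t = p"
        proof (rule ccontr)
          assume "G n t \<noteq> p"
          then have "separated e (x, snd p) (h t, snd (G n t))"
            using robust_separated[OF rob p(1) rangeI, of t x "h t"] px h(2)[of n t] xM hM[of t] by auto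
          then show False using t n by (auto simp: separated_def mem_bowen_ball)
        qed
      qed
      then have "measure unit_lebesgue {t \<in> space unit_lebesgue. h t \<in> bowen_ball X T (snd p) x e}
          \<le> measure unit_lebesgue {t \<in> space unit_lebesgue. G n t = p}"
      proof (rule unit.finite_measure_mono)
        have [measurable]: "G n \<in> measurable unit_lebesgue (count_space UNIV)" by (rule Gm)
        show "{t \<in> space unit_lebesgue. G n t = p} \<in> sets unit_lebesgue" by measurable
      qed
      also have "\<dots> \<le> weight s p" by (rule wt)
      finally have "measure \<mu> (bowen_ball X T (snd p) x e) \<le> weight s p"
        using measure_\<mu>[OF openin_sets_borel_of[OF openin_bowen_ball[OF xM n]]] by simp
      moreover have "birkhoff_sum T f (snd p) (fst p) \<le> birkhoff_sum T f (snd p) x + 1"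
        by (rule robust_birkhoff_sum[OF rob p(1) xM px])
      ultimately show ?thesis using GK(3)[OF p(1)] by blast
    qed
    then have "ereal s \<le> local_pressure_at \<mu> x e" by (rule local_pressure_at_ge)
    also have "\<dots> \<le> upper_local_pressure X T f \<mu> x"
      unfolding upper_local_pressure_eq[OF \<mu> xM] by (rule SUP_upper) (use e in simp)
    finally show ?thesis .
  qed
  moreover have "AE x in \<mu>. x \<in> S"
    using S1 S_sets by (subst \<mu>.AE_in_set_eq_1) (auto simp: \<mu>_def)
  ultimately have "AE x in \<mu>. ereal s \<le> upper_local_pressure X T f \<mu> x" by auto
  then have "ereal s \<le> upper_pressure X T f \<mu>"
    unfolding upper_pressure_def by (intro ereal_integral_ge \<mu>.prob_space_axioms s)
  with \<mu> K1 show ?thesis by blast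
qed

end

section \<open>The variational principle for the packing pressure\<close>

theorem theorem2p11:
  fixes X :: "nat \<Rightarrow> 'a metric"
    and T :: "nat \<Rightarrow> 'a \<Rightarrow> 'a"
    and f :: "nat \<Rightarrow> 'a \<Rightarrow> real"
    and K :: "'a set"
  assumes "nds X T"
    and "K \<noteq> {}"
    and "compactin (mtopology_of (X 0)) K"
    and "continuous_seq X f"
    and "equicontinuous_seq X f"
    and "seq_norm X f < \<infinity>"
    and "packing_pressure X T f K > seq_norm X f"
  shows "packing_pressure X T f K =
    (SUP \<mu> \<in> {\<mu> \<in> borel_probs (X 0). measure \<mu> K = 1}. upper_pressure X T f \<mu>)"
proof -
  interpret bowen_potential X T f
    using assms(1,4) by unfold_locales
  have KM: "K \<subseteq> M" using compactin_subset_topspace[OF assms(3)] by simp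
  obtain x where x: "x \<in> K" using assms(2) by auto
  \<comment> \<open>A point of \<open>K\<close> makes the norm nonnegative, so the packing pressure
    is positive; both integral estimates work at nonnegative levels.\<close>
  have "0 \<le> ereal \<bar>f 0 x\<bar>" by simp
  also have "\<dots> \<le> seq_norm X f"
    unfolding seq_norm_def by (rule SUP_upper2[of 0], simp, rule SUP_upper) (use x KM in auto)
  finally have norm: "0 \<le> seq_norm X f" .
  show ?thesis
  proof (rule antisym)
    show "packing_pressure X T f K \<le> (SUP \<mu> \<in> {\<mu> \<in> borel_probs (X 0). measure \<mu> K = 1}. upper_pressure X T f \<mu>)"
    proof (rule dense_le)
      fix y assume "y < packing_pressure X T f K"
      then have "max y 0 < packing_pressure X T f K" using norm assms(7) by auto
      then obtain s where s: "max y 0 < ereal s" "ereal s < packing_pressure X T f K"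
        using ereal_dense2 by blast
      then have s0: "0 \<le> s" by simp
      obtain e where e: "e > 0" "ereal s < packing_pressure_at X T f K e"
        using s(2) unfolding packing_pressure_eq less_SUP_iff by auto
      have "\<not> packing_sigma_finite s e K"
        using packing_pressure_at_le[of s e K] e by auto
      then obtain \<mu> where "\<mu> \<in> borel_probs (X 0)" "measure \<mu> K = 1" "ereal s \<le> upper_pressure X T f \<mu>"
        using exists_measure_large_pressure[OF assms(3) e(1) s0] by blast
      then have "ereal s \<le> (SUP \<mu> \<in> {\<mu> \<in> borel_probs (X 0). measure \<mu> K = 1}. upper_pressure X T f \<mu>)"
        by (intro SUP_upper2[of \<mu>]) auto
      then show "y \<le> (SUP \<mu> \<in> {\<mu> \<in> borel_probs (X 0). measure \<mu> K = 1}. upper_pressure X T f \<mu>)"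
        using s(1) by (meson less_imp_le max.cobounded1 order_trans)
    qed
  next
    show "(SUP \<mu> \<in> {\<mu> \<in> borel_probs (X 0). measure \<mu> K = 1}. upper_pressure X T f \<mu>) \<le> packing_pressure X T f K"
    \<comment> \<open>Only levels strictly above the packing pressure are tested; if it is infinite
      there are none.\<close>
    proof (rule SUP_least, rule dense_ge)
      fix \<mu> y assume \<mu>: "\<mu> \<in> {\<mu> \<in> borel_probs (X 0). measure \<mu> K = 1}" and y: "packing_pressure X T f K < y"
      then obtain t where t: "packing_pressure X T f K < ereal t" "ereal t < y"
        using ereal_dense2 by blast
      have "0 \<le> ereal t" using norm assms(7) t(1) by (meson less_le_trans less_imp_le order_trans)
      then have "upper_pressure X T f \<mu> \<le> ereal t"
        using \<mu> t(1) KM by (intro upper_pressure_le[of \<mu> K]) auto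
      then show "upper_pressure X T f \<mu> \<le> y" using t(2) by simp
    qed
  qed
qed

end
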